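(* Let $N\ge1$, $\alpha\ge1$, $\sigma_N\ge0$, $U\in\mathcal C^2(\mathbb R)$, $V'(x)=-x/|x|^{\alpha+1}$ for $x\neq0$, and consider the particle system $$dX^i_t=\sqrt{2\sigma_N}\,dB^i_t-U'(X^i_t)\,dt-\frac1N\sum_{j\ne i}V'(X^i_t-X^j_t)\,dt,\qquad i=1,\dots,N.\quad(\ast)$$ (i) Assume $|U''(x)|\le L_U$ for all $x\in\mathbb R$. If $X$ and $Y$ are two solutions of $(\ast)$ driven by the same Brownian motions, then for all $t\ge0$ $$\sum_{i=1}^N(X^i_t-Y^i_t)^2\le e^{2L_Ut}\sum_{i=1}^N(X^i_0-Y^i_0)^2 .$$ This yields strong uniqueness of the solution of $(\ast)$. Let $\rho^{1,N}_t$ and $\rho^{2,N}_t$ denote the laws at time $t$ of the particle systems with respective initial laws $\rho^{1,N}_0$ and $\rho^{2,N}_0$ on $\mathcal O_N$. (ii) If $U(x)=\frac\lambda2x^2$ with $\lambda>0$, then for all $t\ge0$, $\ \mathcal W_2(\rho^{1,N}_t,\rho^{2,N}_t)\le e^{-\lambda t}\,\mathcal W_2(\rho^{1,N}_0,\rho^{2,N}_0)$. (iii) If $|U''(x)|\le L_U$ for all $x\in\mathbb R$, then for all $t\ge0$, $\ \mathcal W_2(\rho^{1,N}_t,\rho^{2,N}_t)\le e^{L_Ut}\,\mathcal W_2(\rho^{1,N}_0,\rho^{2,N}_0)$.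
   Context: $\mathcal O_N=\{(x_1,\dots,x_N)\in\mathbb R^N:\ x_1<\dots<x_N\}$; the $B^i$ are independent Brownian motions, independent of the initial condition. A solution of $(\ast)$ is a continuous adapted process with values in the closure of $\mathcal O_N$, lying in $\mathcal O_N$ for a.e. $t$, with $\int_0^t|V'(X^i_s-X^j_s)|\,ds<\infty$ a.s. for all $t$ and $i\neq j$, satisfying the integral form of $(\ast)$. $\mathcal W_2$ is the $L^2$ Wasserstein distance on probability measures on $\mathbb R^N$ with the Euclidean norm. *)

theory Defs
  imports "HOL-Probability.Probability"
begin

text \<open>Configurations of \<open>N\<close> particles are vectors in \<open>real ^ 'n\<close> where the index type \<open>'n\<close> is an
  arbitrary nonempty finite linear order, standing for \<open>{1, \<dots>, N}\<close> with \<open>N = CARD('n)\<close>.\<close>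

definition ordered_configs :: "(real ^ 'n::{finite,linorder}) set" where
  "ordered_configs = {x. \<forall>i j. i < j \<longrightarrow> x $ i < x $ j}"

text \<open>The value at \<open>0\<close>, where the interaction force is undefined mathematically, is the dummy \<open>0\<close>.
  Solutions (see below) have distinct coordinates at almost every time, so it plays no role.\<close>

definition V' :: "real \<Rightarrow> real \<Rightarrow> real" where
  "V' \<alpha> x = - x / \<bar>x\<bar> powr (\<alpha> + 1)"

definition drift :: "real \<Rightarrow> (real \<Rightarrow> real) \<Rightarrow> real ^ 'n \<Rightarrow> 'n::finite \<Rightarrow> real" where
  "drift \<alpha> U' x i = - U' (x $ i) - 1 / real CARD('n) * (\<Sum>j\<in>UNIV - {i}. V' \<alpha> (x $ i - x $ j))"

text \<open>Time is \<open>[0, \<infinity>)\<close>, embedded in \<open>real\<close>: nothing is ever required of a process at negative times,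
  and a filtration indexed by \<open>[0, \<infinity>)\<close> is extended by \<open>F t = F 0\<close> for \<open>t < 0\<close>.\<close>

definition filtered_prob_space :: "'a measure \<Rightarrow> (real \<Rightarrow> 'a measure) \<Rightarrow> bool" where
  "filtered_prob_space M F \<longleftrightarrow>
     prob_space M \<and> filtration (space M) F \<and> (\<forall>t. subalgebra M (F t))"

definition adapted :: "(real \<Rightarrow> 'a measure) \<Rightarrow> (real \<Rightarrow> 'a \<Rightarrow> 'b::topological_space) \<Rightarrow> bool" where
  "adapted F X \<longleftrightarrow> (\<forall>t\<ge>0. X t \<in> borel_measurable (F t))"

definition continuous_paths ::
    "'a measure \<Rightarrow> (real \<Rightarrow> 'a \<Rightarrow> 'b::topological_space) \<Rightarrow> bool" where
  "continuous_paths M X \<longleftrightarrow> (AE \<omega> in M. continuous_on {0..} (\<lambda>t. X t \<omega>))"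

text \<open>The coordinates are independent standard Brownian motions relative to \<open>F\<close>. As every increment
  after time \<open>s\<close> is independent of \<open>F s\<close>, the whole process is independent of \<open>F 0\<close>, hence of the
  initial condition of every process adapted to \<open>F\<close>.\<close>

definition brownian_motion ::
    "'a measure \<Rightarrow> (real \<Rightarrow> 'a measure) \<Rightarrow> (real \<Rightarrow> 'a \<Rightarrow> real ^ 'n::finite) \<Rightarrow> bool" where
  "brownian_motion M F B \<longleftrightarrow>
     adapted F B \<and>
     (AE \<omega> in M. B 0 \<omega> = 0) \<and>
     continuous_paths M B \<and>
     (\<forall>s t. 0 \<le> s \<and> s < t \<longrightarrow>
        prob_space.indep_set M (sets (F s))
          (sets (vimage_algebra (space M) (\<lambda>\<omega>. B t \<omega> - B s \<omega>) borel)) \<and>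
        prob_space.indep_vars M (\<lambda>_. borel) (\<lambda>i \<omega>. B t \<omega> $ i - B s \<omega> $ i) UNIV \<and>
        (\<forall>i. distributed M lborel (\<lambda>\<omega>. B t \<omega> $ i - B s \<omega> $ i)
               (normal_density 0 (sqrt (t - s)))))"

definition particle_solution ::
    "real \<Rightarrow> real \<Rightarrow> (real \<Rightarrow> real) \<Rightarrow> 'a measure \<Rightarrow> (real \<Rightarrow> 'a measure) \<Rightarrow>
     (real \<Rightarrow> 'a \<Rightarrow> real ^ 'n::{finite,linorder}) \<Rightarrow>
     (real \<Rightarrow> 'a \<Rightarrow> real ^ 'n::{finite,linorder}) \<Rightarrow> bool" where
  "particle_solution \<alpha> \<sigma> U' M F B X \<longleftrightarrow>
     filtered_prob_space M F \<and>
     brownian_motion M F B \<and>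
     adapted F X \<and>
     continuous_paths M X \<and>
     (AE \<omega> in M. \<forall>t\<ge>0. X t \<omega> \<in> closure ordered_configs) \<and>
     (AE \<omega> in M. AE t in lborel. 0 \<le> t \<longrightarrow> X t \<omega> \<in> ordered_configs) \<and>
     (AE \<omega> in M. \<forall>t\<ge>0. \<forall>i j. i \<noteq> j \<longrightarrow>
        set_integrable lborel {0..t} (\<lambda>s. V' \<alpha> (X s \<omega> $ i - X s \<omega> $ j))) \<and>
     (AE \<omega> in M. \<forall>t\<ge>0. \<forall>i.
        X t \<omega> $ i = X 0 \<omega> $ i + sqrt (2 * \<sigma>) * B t \<omega> $ i
          + (LINT s:{0..t}|lborel. drift \<alpha> U' (X s \<omega>) i))"

definition couplings :: "'a measure \<Rightarrow> 'b measure \<Rightarrow> ('a \<times> 'b) measure set" where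
  "couplings \<mu> \<nu> = {\<pi>. sets \<pi> = sets (\<mu> \<Otimes>\<^sub>M \<nu>) \<and> distr \<pi> \<mu> fst = \<mu> \<and> distr \<pi> \<nu> snd = \<nu>}"

definition sqrt_ennreal :: "ennreal \<Rightarrow> ennreal" where
  "sqrt_ennreal x = (if x = \<top> then \<top> else ennreal (sqrt (enn2real x)))"

text \<open>Extended-valued: no second moments are assumed.\<close>

definition wasserstein2 ::
    "('a::metric_space) measure \<Rightarrow> 'a measure \<Rightarrow> ennreal" where
  "wasserstein2 \<mu> \<nu> =
     sqrt_ennreal (INF \<pi>\<in>couplings \<mu> \<nu>. \<integral>\<^sup>+ p. ennreal ((dist (fst p) (snd p))\<^sup>2) \<partial>\<pi>)"

end

theory Submission
  imports Defs
begin

text \<open>Cutting the repulsion off at distance \<open>1 / (n + 1)\<close> turns the drift into a Lipschitz map which keeps the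
  one-sided bound \<open>(x - y) \<bullet> (b x - b y) \<le> c |x - y|\<^sup>2\<close>, because the force between two
  ordered particles decreases with their distance. The explicit Euler scheme for the truncated drift is
  a function of the driving path \<open>X\<^sub>0 + \<surd>(2\<sigma>) B\<close> alone. It converges to any solution driven by that path
  as first the step size tends to \<open>0\<close> and then the cutoff is removed (the integrability of the forces
  gives the dominated convergence), and it is stable with constant close to \<open>exp (c t)\<close>. This proves
  (i) path by path.

  For (ii) and (iii), take a coupling \<open>\<pi>\<close> of the initial laws and the product of \<open>\<pi>\<close> with the first
  probability space, and drive two copies of the scheme from the two components of \<open>\<pi>\<close> by the same
  Brownian motion. The law of a driving path depends only on its initial law, so along a
  subsequence common to both solutions the schemes converge almost surely on the product space, to limits
  with the laws of the two solutions. No weak existence theorem and no disintegration is needed.\<close>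

section \<open>Euler schemes for one-sided Lipschitz drifts\<close>

text \<open>For (i) alone the noise cancels in X - Y, and a Gronwall estimate on one probability
  space would do. In (ii) and (iii) the solutions live on unrelated probability spaces with
  unrelated Brownian motions, and a synchronous coupling needs each solution as a measurable
  function of its driving path. The scheme supplies that function, and (i) then follows from the
  same estimate. Two features shape the details. The Lipschitz constant of the truncated drift is
  tied to the cutoff, so the step size must go to 0 with the cutoff fixed; the thresholds in this
  double limit depend on the sample point, and only in measure can one subsequence be chosen for
  both solutions. Moreover the one-sided constant c is -\<lambda> in (ii), so the stability estimate
  must keep its exact value, while the consistency estimate can afford |c|.\<close>

primrec euler :: "('v \<Rightarrow> 'v) \<Rightarrow> real \<Rightarrow> (real \<Rightarrow> 'v::real_inner) \<Rightarrow> nat \<Rightarrow> 'v" where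
  "euler b h y 0 = y 0"
| "euler b h y (Suc k) =
     euler b h y k + h *\<^sub>R b (euler b h y k) + (y (real (Suc k) * h) - y (real k * h))"

text \<open>Expanding the square gives the factor 1 + 2hc + h^2 \<Lambda>^2, and 1 + z \<le> exp z
  holds for every real z, so negative \<open>c\<close> is allowed. The cross term carries the sharp
  constant; \<Lambda> enters only at order h^2.\<close>

lemma euler_step_bound:
  fixes b :: "'v::real_inner \<Rightarrow> 'v"
  assumes lip: "\<And>u v. norm (b u - b v) \<le> \<Lambda> * norm (u - v)"
    and osl: "\<And>u v. (u - v) \<bullet> (b u - b v) \<le> c * (norm (u - v))\<^sup>2"
    and h: "0 \<le> h"
  shows "norm ((u - v) + h *\<^sub>R (b u - b v)) \<le> exp (h * c + h\<^sup>2 * \<Lambda>\<^sup>2 / 2) * norm (u - v)"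
proof (rule power2_le_imp_le)
  let ?e = "u - v" and ?d = "b u - b v"
  have "(norm ?d)\<^sup>2 \<le> (\<Lambda> * norm ?e)\<^sup>2"
    using lip by (intro power_mono) auto
  then have "h\<^sup>2 * (norm ?d)\<^sup>2 \<le> h\<^sup>2 * (\<Lambda>\<^sup>2 * (norm ?e)\<^sup>2)"
    by (intro mult_left_mono) (auto simp: power_mult_distrib)
  moreover have "2 * h * (?e \<bullet> ?d) \<le> 2 * h * (c * (norm ?e)\<^sup>2)"
    using osl h by (intro mult_left_mono) auto
  moreover have "(norm (?e + h *\<^sub>R ?d))\<^sup>2 = (norm ?e)\<^sup>2 + 2 * h * (?e \<bullet> ?d) + h\<^sup>2 * (norm ?d)\<^sup>2"
    unfolding power2_norm_eq_inner
    by (simp add: inner_add_left inner_add_right inner_commute power2_eq_square)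
  ultimately have "(norm (?e + h *\<^sub>R ?d))\<^sup>2 \<le> (1 + (2 * h * c + h\<^sup>2 * \<Lambda>\<^sup>2)) * (norm ?e)\<^sup>2"
    by (simp add: algebra_simps)
  also have "\<dots> \<le> exp (2 * h * c + h\<^sup>2 * \<Lambda>\<^sup>2) * (norm ?e)\<^sup>2"
    by (intro mult_right_mono exp_ge_add_one_self) auto
  also have "\<dots> = (exp (h * c + h\<^sup>2 * \<Lambda>\<^sup>2 / 2) * norm ?e)\<^sup>2"
    by (simp add: power_mult_distrib exp_double[symmetric] algebra_simps)
  finally show "(norm (?e + h *\<^sub>R ?d))\<^sup>2 \<le> (exp (h * c + h\<^sup>2 * \<Lambda>\<^sup>2 / 2) * norm ?e)\<^sup>2" .
qed simp

text \<open>The two driving paths differ by a constant, so their increments agree, the noise drops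
  out of the difference of the schemes, and the one-step bound iterates.\<close>

lemma euler_stable:
  fixes b :: "'v::real_inner \<Rightarrow> 'v"
  assumes lip: "\<And>u v. norm (b u - b v) \<le> \<Lambda> * norm (u - v)"
    and osl: "\<And>u v. (u - v) \<bullet> (b u - b v) \<le> c * (norm (u - v))\<^sup>2"
    and h: "0 \<le> h"
    and shift: "\<And>s. 0 \<le> s \<Longrightarrow> y s - y' s = y 0 - y' 0"
  shows "norm (euler b h y k - euler b h y' k)
    \<le> exp (h * c + h\<^sup>2 * \<Lambda>\<^sup>2 / 2) ^ k * norm (y 0 - y' 0)"
proof (induction k)
  case (Suc k)
  let ?u = "euler b h y k" and ?v = "euler b h y' k"
  have inc: "y (real (Suc k) * h) - y' (real (Suc k) * h) = y (real k * h) - y' (real k * h)"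
    using shift[of "real (Suc k) * h"] shift[of "real k * h"] h by simp
  have "euler b h y (Suc k) - euler b h y' (Suc k) = (?u - ?v) + h *\<^sub>R (b ?u - b ?v)
      + ((y (real (Suc k) * h) - y' (real (Suc k) * h)) - (y (real k * h) - y' (real k * h)))"
    by (simp only: euler.simps algebra_simps)
  also have "\<dots> = (?u - ?v) + h *\<^sub>R (b ?u - b ?v)"
    by (simp only: inc) simp
  finally have "norm (euler b h y (Suc k) - euler b h y' (Suc k))
      \<le> exp (h * c + h\<^sup>2 * \<Lambda>\<^sup>2 / 2) * norm (?u - ?v)"
    using euler_step_bound[OF lip osl h] by (simp only:)
  also have "\<dots> \<le> exp (h * c + h\<^sup>2 * \<Lambda>\<^sup>2 / 2)
      * (exp (h * c + h\<^sup>2 * \<Lambda>\<^sup>2 / 2) ^ k * norm (y 0 - y' 0))"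
    using Suc by (intro mult_left_mono) auto
  finally show ?case by simp
qed simp

text \<open>A discrete Gronwall estimate: \<open>r k\<close> is the defect with which
  \<open>x\<close> satisfies the recursion of the scheme. With \<open>0 \<le> c\<close> every growth
  factor is at least 1, so each defect may be charged the full power.\<close>

lemma euler_consistent:
  fixes b :: "'v::real_inner \<Rightarrow> 'v"
  assumes lip: "\<And>u v. norm (b u - b v) \<le> \<Lambda> * norm (u - v)"
    and osl: "\<And>u v. (u - v) \<bullet> (b u - b v) \<le> c * (norm (u - v))\<^sup>2"
    and h: "0 \<le> h" and c: "0 \<le> c"
    and start: "x 0 = y 0"
    and step: "\<And>k. k < m \<Longrightarrow> x (real (Suc k) * h) = x (real k * h)
        + (y (real (Suc k) * h) - y (real k * h)) + h *\<^sub>R b (x (real k * h)) + r k"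
    and k: "k \<le> m"
  shows "norm (x (real k * h) - euler b h y k)
    \<le> exp (h * c + h\<^sup>2 * \<Lambda>\<^sup>2 / 2) ^ k * (\<Sum>j<k. norm (r j))"
  using k
proof (induction k)
  case (Suc k)
  let ?q = "exp (h * c + h\<^sup>2 * \<Lambda>\<^sup>2 / 2)"
  let ?u = "x (real k * h)" and ?v = "euler b h y k"
  have q: "1 \<le> ?q" using h c by simp
  have "x (real (Suc k) * h) - euler b h y (Suc k) = ((?u - ?v) + h *\<^sub>R (b ?u - b ?v)) + r k"
    using Suc.prems step[of k] by (simp add: algebra_simps)
  then have "norm (x (real (Suc k) * h) - euler b h y (Suc k))
      \<le> norm ((?u - ?v) + h *\<^sub>R (b ?u - b ?v)) + norm (r k)"
    by (simp only: norm_triangle_ineq)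
  also have "\<dots> \<le> ?q * norm (?u - ?v) + 1 * norm (r k)"
    using euler_step_bound[OF lip osl h] by simp
  also have "\<dots> \<le> ?q * (?q ^ k * (\<Sum>j<k. norm (r j))) + ?q ^ Suc k * norm (r k)"
    using Suc one_le_power[OF q, of "Suc k"]
    by (intro add_mono mult_left_mono mult_right_mono) auto
  also have "\<dots> = ?q ^ Suc k * (\<Sum>j<Suc k. norm (r j))"
    by (simp add: algebra_simps)
  finally show ?case .
qed (simp add: start)

section \<open>The truncated drift\<close>

text \<open>The cutoff \<open>max d (1 / (n + 1))\<close> is finite and monotone for all real \<open>d\<close>, so that the one-sided bound
  holds on all configurations and the Euler iterates need not stay ordered.\<close>

definition trunc_force :: "real \<Rightarrow> nat \<Rightarrow> real \<Rightarrow> real" where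
  "trunc_force \<alpha> n d = max d (1 / real (Suc n)) powr (- \<alpha>)"

text \<open>The sign is read off the indices, not off the coordinates. On ordered configurations the
  two agree; elsewhere this choice keeps the force nondecreasing in x_i - x_j, whereas the singular
  \<open>V'\<close> drops from positive to negative values across 0.\<close>

definition trunc_pair ::
    "real \<Rightarrow> nat \<Rightarrow> real ^ 'n::{finite,linorder} \<Rightarrow> 'n \<Rightarrow> 'n \<Rightarrow> real" where
  "trunc_pair \<alpha> n x i j =
     (if j < i then - trunc_force \<alpha> n (x $ i - x $ j)
      else if i < j then trunc_force \<alpha> n (x $ j - x $ i) else 0)"

definition trunc_drift ::
    "real \<Rightarrow> (real \<Rightarrow> real) \<Rightarrow> nat \<Rightarrow> real ^ 'n::{finite,linorder} \<Rightarrow> real ^ 'n::{finite,linorder}" where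
  "trunc_drift \<alpha> U' n x =
     (\<chi> i. - U' (x $ i) - 1 / real CARD('n) * (\<Sum>j\<in>UNIV. trunc_pair \<alpha> n x i j))"

lemma trunc_force_antimono:
  assumes "0 \<le> \<alpha>" "d \<le> d'"
  shows "trunc_force \<alpha> n d' \<le> trunc_force \<alpha> n d"
  unfolding trunc_force_def using assms
  by (intro powr_mono2') (auto simp: less_max_iff_disj)

text \<open>On [a, \<infinity>) with a = 1/(n+1) the derivative of the power is at most \<alpha>
  a^(-\<alpha>-1) in absolute value, and taking the maximum with \<open>a\<close> is
  1-Lipschitz.\<close>

lemma trunc_force_lipschitz:
  assumes "0 \<le> \<alpha>"
  shows "\<exists>C\<ge>0. \<forall>d d'. \<bar>trunc_force \<alpha> n d - trunc_force \<alpha> n d'\<bar> \<le> C * \<bar>d - d'\<bar>"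
proof -
  define a where "a = 1 / real (Suc n)"
  have a: "a > 0" by (simp add: a_def)
  define C where "C = \<alpha> * a powr (- \<alpha> - 1)"
  have "norm (x powr (- \<alpha>) - y powr (- \<alpha>)) \<le> C * norm (x - y)" if "x \<in> {a..}" "y \<in> {a..}" for x y
  proof (rule field_differentiable_bound[OF _ _ _ that])
    fix z assume z: "z \<in> {a..}"
    with a have "z > 0" by simp
    then show "((\<lambda>x. x powr (- \<alpha>)) has_field_derivative (- \<alpha> * z powr (- \<alpha> - 1))) (at z within {a..})"
      by (auto intro!: derivative_eq_intros)
    have "z powr (- \<alpha> - 1) \<le> a powr (- \<alpha> - 1)"
      using z a assms by (intro powr_mono2') auto
    then show "norm (- \<alpha> * z powr (- \<alpha> - 1)) \<le> C"
      using assms by (auto simp: C_def abs_mult intro: mult_left_mono)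
  qed auto
  then have "\<bar>trunc_force \<alpha> n d - trunc_force \<alpha> n d'\<bar> \<le> C * \<bar>max d a - max d' a\<bar>" for d d'
    unfolding trunc_force_def a_def by simp
  moreover have "C \<ge> 0" using assms by (simp add: C_def)
  moreover have "\<bar>max d a - max d' a\<bar> \<le> \<bar>d - d'\<bar>" for d d' by simp
  ultimately show ?thesis
    by (meson mult_left_mono order_trans)
qed

lemma trunc_pair_antisym: "trunc_pair \<alpha> n x j i = - trunc_pair \<alpha> n x i j"
  by (auto simp: trunc_pair_def)

text \<open>Both off-diagonal branches are nondecreasing in the difference of the two coordinates:
  \<open>trunc_force\<close> is antitone, and either its sign or its argument is reversed.\<close>

lemma trunc_pair_monotone:
  assumes "0 \<le> \<alpha>"
  shows "0 \<le> ((x $ i - x $ j) - (y $ i - y $ j)) * (trunc_pair \<alpha> n x i j - trunc_pair \<alpha> n y i j)"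
proof -
  have *: "0 \<le> (d - d') * (trunc_force \<alpha> n d' - trunc_force \<alpha> n d)" for d d'
    using trunc_force_antimono[OF assms, of d d' n] trunc_force_antimono[OF assms, of d' d n]
    by (cases "d \<le> d'") (auto simp: mult_nonneg_nonneg mult_nonpos_nonpos)
  show ?thesis
    using *[of "x $ i - x $ j" "y $ i - y $ j"] *[of "x $ j - x $ i" "y $ j - y $ i"]
    by (auto simp: trunc_pair_def algebra_simps)
qed

text \<open>Antisymmetry turns the interaction term into half the sum of (e_i - e_j) g_ij, whose
  terms are nonnegative by monotonicity. The drift carries this sum with a minus sign, so the
  repulsion can only help, and \<open>c\<close> comes from \<open>U'\<close> alone.\<close>

lemma trunc_drift_one_sided:
  fixes x y :: "real ^ 'n::{finite,linorder}"
  assumes \<alpha>: "0 \<le> \<alpha>" and c: "\<And>u v. - c * (u - v)\<^sup>2 \<le> (u - v) * (U' u - U' v)"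
  shows "(x - y) \<bullet> (trunc_drift \<alpha> U' n x - trunc_drift \<alpha> U' n y) \<le> c * (norm (x - y))\<^sup>2"
proof -
  let ?e = "x - y"
  define g where "g i j = trunc_pair \<alpha> n x i j - trunc_pair \<alpha> n y i j" for i j
  have anti: "g j i = - g i j" for i j
    unfolding g_def using trunc_pair_antisym[of \<alpha> n x j i] trunc_pair_antisym[of \<alpha> n y j i] by simp
  have "(\<Sum>i\<in>UNIV. \<Sum>j\<in>UNIV. ?e $ j * g i j) = (\<Sum>i\<in>UNIV. \<Sum>j\<in>UNIV. ?e $ i * g j i)"
    by (rule sum.swap)
  also have "\<dots> = - (\<Sum>i\<in>UNIV. \<Sum>j\<in>UNIV. ?e $ i * g i j)"
    by (subst anti) (simp add: sum_negf)
  finally have "2 * (\<Sum>i\<in>UNIV. \<Sum>j\<in>UNIV. ?e $ i * g i j)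
      = (\<Sum>i\<in>UNIV. \<Sum>j\<in>UNIV. (?e $ i - ?e $ j) * g i j)"
    by (simp add: sum_subtractf left_diff_distrib)
  also have "\<dots> \<ge> 0"
    using trunc_pair_monotone[OF \<alpha>, of x _ _ y n]
    by (intro sum_nonneg) (simp add: g_def algebra_simps)
  finally have "0 \<le> (\<Sum>i\<in>UNIV. \<Sum>j\<in>UNIV. ?e $ i * g i j)"
    by simp
  then have G: "0 \<le> (\<Sum>i\<in>UNIV. ?e $ i * (\<Sum>j\<in>UNIV. g i j))"
    by (simp add: sum_distrib_left)
  have "?e \<bullet> (trunc_drift \<alpha> U' n x - trunc_drift \<alpha> U' n y)
      = (\<Sum>i\<in>UNIV. - (?e $ i * (U' (x $ i) - U' (y $ i)))
          - 1 / real CARD('n) * (?e $ i * (\<Sum>j\<in>UNIV. g i j)))"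
    unfolding inner_vec_def trunc_drift_def g_def
    by (intro sum.cong) (auto simp: sum_subtractf diff_divide_distrib algebra_simps)
  also have "\<dots> = - (\<Sum>i\<in>UNIV. ?e $ i * (U' (x $ i) - U' (y $ i)))
      - 1 / real CARD('n) * (\<Sum>i\<in>UNIV. ?e $ i * (\<Sum>j\<in>UNIV. g i j))"
    by (simp only: sum_subtractf sum_negf sum_distrib_left)
  also have "\<dots> \<le> - (\<Sum>i\<in>UNIV. ?e $ i * (U' (x $ i) - U' (y $ i)))"
    using G by simp
  also have "\<dots> \<le> (\<Sum>i\<in>UNIV. c * (?e $ i)\<^sup>2)"
    unfolding sum_negf[symmetric]
  proof (rule sum_mono)
    fix i
    show "- (?e $ i * (U' (x $ i) - U' (y $ i))) \<le> c * (?e $ i)\<^sup>2"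
      using c[of "x $ i" "y $ i"] by simp
  qed
  also have "\<dots> = c * (norm ?e)\<^sup>2"
    unfolding power2_norm_eq_inner inner_vec_def by (simp add: sum_distrib_left power2_eq_square)
  finally show ?thesis .
qed

text \<open>The difference x_i - x_j moves by at most twice |x - y|, so each pair force inherits the
  Lipschitz constant of \<open>trunc_force\<close> with a factor 2. The constant is tied to the
  cutoff, which is why \<open>n\<close> stays fixed while the step size tends to 0.\<close>

lemma trunc_drift_lipschitz:
  assumes \<alpha>: "0 \<le> \<alpha>" and K: "\<And>u v. \<bar>U' u - U' v\<bar> \<le> K * \<bar>u - v\<bar>"
  shows "\<exists>\<Lambda>\<ge>0. \<forall>x y :: real ^ 'n::{finite,linorder}.
    norm (trunc_drift \<alpha> U' n x - trunc_drift \<alpha> U' n y) \<le> \<Lambda> * norm (x - y)"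
proof -
  obtain C where C: "C \<ge> 0"
    "\<And>d d'. \<bar>trunc_force \<alpha> n d - trunc_force \<alpha> n d'\<bar> \<le> C * \<bar>d - d'\<bar>"
    using trunc_force_lipschitz[OF \<alpha>, of n] by blast
  have K0: "K \<ge> 0" using K[of 1 0] by simp
  have pair: "\<bar>trunc_pair \<alpha> n x i j - trunc_pair \<alpha> n y i j\<bar> \<le> 2 * C * norm (x - y)"
    for x y :: "(real, 'n) vec" and i j
  proof -
    have e: "\<bar>x $ k - y $ k\<bar> \<le> norm (x - y)" for k
      using component_le_norm_cart[of "x - y" k] by simp
    have "\<bar>(x $ k - x $ l) - (y $ k - y $ l)\<bar> \<le> 2 * norm (x - y)" for k l
      using e[of k] e[of l] by linarith
    then have "C * \<bar>(x $ k - x $ l) - (y $ k - y $ l)\<bar> \<le> C * (2 * norm (x - y))" for k l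
      using C(1) by (intro mult_left_mono) auto
    then have *: "\<bar>trunc_force \<alpha> n (x $ k - x $ l) - trunc_force \<alpha> n (y $ k - y $ l)\<bar>
        \<le> 2 * C * norm (x - y)" for k l
      using C(2)[of "x $ k - x $ l" "y $ k - y $ l"] by (simp add: algebra_simps) (meson order_trans)
    show ?thesis
      using *[of i j] *[of j i] C(1) by (auto simp: trunc_pair_def abs_minus_commute)
  qed
  have comp: "\<bar>trunc_drift \<alpha> U' n x $ i - trunc_drift \<alpha> U' n y $ i\<bar> \<le> (K + 2 * C) * norm (x - y)"
    for x y :: "(real, 'n) vec" and i
  proof -
    have "\<bar>\<Sum>j\<in>UNIV. trunc_pair \<alpha> n x i j - trunc_pair \<alpha> n y i j\<bar>
        \<le> (\<Sum>j\<in>UNIV. \<bar>trunc_pair \<alpha> n x i j - trunc_pair \<alpha> n y i j\<bar>)"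
      by (rule sum_abs)
    also have "\<dots> \<le> real CARD('n) * (2 * C * norm (x - y))"
      using sum_bounded_above[of UNIV "\<lambda>j. \<bar>trunc_pair \<alpha> n x i j - trunc_pair \<alpha> n y i j\<bar>"] pair by simp
    finally have "\<bar>1 / real CARD('n) * (\<Sum>j\<in>UNIV. trunc_pair \<alpha> n x i j - trunc_pair \<alpha> n y i j)\<bar>
        \<le> 2 * C * norm (x - y)"
      by (simp add: abs_mult field_simps)
    moreover have "\<bar>U' (x $ i) - U' (y $ i)\<bar> \<le> K * norm (x - y)"
    proof -
      have "K * \<bar>x $ i - y $ i\<bar> \<le> K * norm (x - y)"
        using component_le_norm_cart[of "x - y" i] K0 by (intro mult_left_mono) auto
      with K[of "x $ i" "y $ i"] show ?thesis by linarith
    qed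
    ultimately show ?thesis
      unfolding trunc_drift_def by (simp add: sum_subtractf algebra_simps)
  qed
  have "norm (trunc_drift \<alpha> U' n x - trunc_drift \<alpha> U' n y)
      \<le> (real CARD('n) * (K + 2 * C)) * norm (x - y)" for x y :: "(real, 'n) vec"
  proof -
    have "norm (trunc_drift \<alpha> U' n x - trunc_drift \<alpha> U' n y)
      \<le> (\<Sum>i\<in>UNIV. \<bar>(trunc_drift \<alpha> U' n x - trunc_drift \<alpha> U' n y) $ i\<bar>)"
      by (rule norm_le_l1_cart)
    also have "\<dots> \<le> (\<Sum>i\<in>(UNIV :: 'n set). (K + 2 * C) * norm (x - y))"
      using comp by (intro sum_mono) simp
    finally show ?thesis by simp
  qed
  moreover have "0 \<le> real CARD('n) * (K + 2 * C)" using K0 C(1) by simp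
  ultimately show ?thesis by blast
qed

text \<open>Raising the argument to at least 1/(n+1) can only weaken the force, and it changes
  nothing once 1/(n+1) lies below the gap between the two particles. These are the domination and
  the pointwise limit for dominated convergence.\<close>

lemma trunc_pair_bound:
  assumes \<alpha>: "0 \<le> \<alpha>" and x: "x \<in> ordered_configs" and ij: "i \<noteq> j"
  shows "\<bar>trunc_pair \<alpha> n x i j\<bar> \<le> \<bar>V' \<alpha> (x $ i - x $ j)\<bar>"
    and "\<forall>\<^sub>F n in sequentially. trunc_pair \<alpha> n x i j = V' \<alpha> (x $ i - x $ j)"
proof -
  have V: "V' \<alpha> d = - (d powr (- \<alpha>))" "V' \<alpha> (- d) = d powr (- \<alpha>)" if "d > 0" for d
    using that by (auto simp: V'_def powr_add powr_minus field_simps)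
  have pos: "0 < x $ k - x $ l" if "l < k" for k l
    using x that by (auto simp: ordered_configs_def)
  have bd: "0 \<le> trunc_force \<alpha> n d \<and> trunc_force \<alpha> n d \<le> d powr (- \<alpha>)" if "d > 0" for d n
    unfolding trunc_force_def using that \<alpha> by (auto intro!: powr_mono2')
  have ev: "\<forall>\<^sub>F n in sequentially. trunc_force \<alpha> n d = d powr (- \<alpha>)" if "d > 0" for d
  proof -
    have "\<forall>\<^sub>F n in sequentially. 1 / real (Suc n) < d"
      using order_tendstoD(2)[OF LIMSEQ_inverse_real_of_nat that] by (simp add: inverse_eq_divide)
    then show ?thesis
      by eventually_elim (simp add: trunc_force_def max_def)
  qed
  consider "j < i" | "i < j" using ij by (meson linorder_neqE)
  then have "\<bar>trunc_pair \<alpha> n x i j\<bar> \<le> \<bar>V' \<alpha> (x $ i - x $ j)\<bar>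
    \<and> (\<forall>\<^sub>F n in sequentially. trunc_pair \<alpha> n x i j = V' \<alpha> (x $ i - x $ j))"
  proof cases
    case 1
    with bd[OF pos[OF 1]] ev[OF pos[OF 1]] V(1)[OF pos[OF 1]] show ?thesis
      by (auto simp: trunc_pair_def)
  next
    case 2
    with bd[OF pos[OF 2]] ev[OF pos[OF 2]] V(2)[OF pos[OF 2]] show ?thesis
      by (auto simp: trunc_pair_def)
  qed
  then show "\<bar>trunc_pair \<alpha> n x i j\<bar> \<le> \<bar>V' \<alpha> (x $ i - x $ j)\<bar>"
    "\<forall>\<^sub>F n in sequentially. trunc_pair \<alpha> n x i j = V' \<alpha> (x $ i - x $ j)" by auto
qed

section \<open>Pathwise convergence and stability\<close>

text \<open>The argument \<open>y\<close> is the driving path: the initial value plus the noise.\<close>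

definition path_solution ::
    "real \<Rightarrow> (real \<Rightarrow> real) \<Rightarrow> (real \<Rightarrow> real ^ 'n::{finite,linorder}) \<Rightarrow>
     (real \<Rightarrow> real ^ 'n::{finite,linorder}) \<Rightarrow> bool" where
  "path_solution \<alpha> U' y x \<longleftrightarrow>
     continuous_on {0..} x \<and>
     (AE t in lborel. 0 \<le> t \<longrightarrow> x t \<in> ordered_configs) \<and>
     (\<forall>t\<ge>0. \<forall>i j. i \<noteq> j \<longrightarrow> set_integrable lborel {0..t} (\<lambda>s. V' \<alpha> (x s $ i - x s $ j))) \<and>
     (\<forall>t\<ge>0. \<forall>i. x t $ i = y t $ i + (LINT s:{0..t}|lborel. drift \<alpha> U' (x s) i))"

lemma sum_integral_grid:
  fixes g :: "real \<Rightarrow> real"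
  assumes h: "0 \<le> h" and g: "g integrable_on {0..real k * h}"
  shows "(\<Sum>j<k. integral {real j * h..real (Suc j) * h} g) = integral {0..real k * h} g"
  using g
proof (induction k)
  case (Suc k)
  have le: "real k * h \<le> real (Suc k) * h"
    using h by (intro mult_right_mono) auto
  have "g integrable_on {0..real k * h}"
    using Suc.prems by (rule integrable_on_subinterval) (use le in auto)
  with Suc.IH have "(\<Sum>j<Suc k. integral {real j * h..real (Suc j) * h} g)
      = integral {0..real k * h} g + integral {real k * h..real (Suc k) * h} g"
    by simp
  also have "\<dots> = integral {0..real (Suc k) * h} g"
    using h le Suc.prems by (intro Henstock_Kurzweil_Integration.integral_combine) auto
  finally show ?case .
qed simp

lemma set_integrable_sum:
  fixes f :: "'i \<Rightarrow> 'b \<Rightarrow> real"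
  assumes "\<And>i. i \<in> I \<Longrightarrow> set_integrable M A (f i)"
  shows "set_integrable M A (\<lambda>x. \<Sum>i\<in>I. f i x)"
  using assms unfolding set_integrable_def scaleR_sum_right by (rule Bochner_Integration.integrable_sum)

text \<open>The constant \<open>c\<close> may have either sign: it is a bound on |U''| in (i) and
  (iii), and -\<lambda> for the quadratic potential. It alone enters the final rates, whereas
  \<open>K\<close> serves for regularity of the drifts.\<close>

locale one_sided_drift =
  fixes \<alpha> :: real and U' :: "real \<Rightarrow> real" and c K :: real
  assumes \<alpha>: "0 \<le> \<alpha>"
    and one_sided: "\<And>u v. - c * (u - v)\<^sup>2 \<le> (u - v) * (U' u - U' v)"
    and lipschitz: "\<And>u v. \<bar>U' u - U' v\<bar> \<le> K * \<bar>u - v\<bar>"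
begin

text \<open>The m + 1 steps of length t / (m + 1) end exactly at time \<open>t\<close>; the
  successor keeps the step size meaningful at m = 0.\<close>

definition scheme :: "nat \<Rightarrow> nat \<Rightarrow> real \<Rightarrow> (real \<Rightarrow> real ^ 'n::{finite,linorder}) \<Rightarrow> real ^ 'n::{finite,linorder}" where
  "scheme n m t y = euler (trunc_drift \<alpha> U' n) (t / real (Suc m)) y (Suc m)"

lemma U'_continuous: "continuous_on UNIV U'"
proof -
  have "0 \<le> K" using lipschitz[of 1 0] by simp
  then have "K-lipschitz_on UNIV U'"
    using lipschitz by (intro lipschitz_onI) (auto simp: dist_real_def)
  then show ?thesis by (rule lipschitz_on_continuous_on)
qed

lemma trunc_drift_continuous:
  "continuous_on UNIV (trunc_drift \<alpha> U' n :: real ^ 'n::{finite,linorder} \<Rightarrow> _)"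
proof -
  obtain \<Lambda> where "0 \<le> \<Lambda>"
    "\<And>x y :: (real, 'n) vec. norm (trunc_drift \<alpha> U' n x - trunc_drift \<alpha> U' n y) \<le> \<Lambda> * norm (x - y)"
    using trunc_drift_lipschitz[OF \<alpha> lipschitz] by blast
  then have "\<Lambda>-lipschitz_on UNIV (trunc_drift \<alpha> U' n :: (real, 'n) vec \<Rightarrow> _)"
    by (intro lipschitz_onI) (auto simp: dist_norm)
  then show ?thesis by (rule lipschitz_on_continuous_on)
qed

text \<open>Over the whole grid the exponents add up to ct + t^2 \<Lambda>^2 / (2 (m + 1)), and the
  second term vanishes for fixed \<open>n\<close>. The threshold in \<open>m\<close> is the same for
  all pairs of driving paths, so on a probability space this bound costs no exceptional set.\<close>

lemma scheme_stable:
  fixes t \<eta> :: real and n :: nat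
  assumes t: "0 \<le> t" and \<eta>: "0 < \<eta>"
  shows "\<forall>\<^sub>F m in sequentially. \<forall>y y' :: real \<Rightarrow> real ^ 'n::{finite,linorder}.
    (\<forall>s\<ge>0. y s - y' s = y 0 - y' 0) \<longrightarrow>
    norm (scheme n m t y - scheme n m t y') \<le> (exp (c * t) + \<eta>) * norm (y 0 - y' 0)"
proof -
  obtain \<Lambda> where \<Lambda>: "0 \<le> \<Lambda>"
    "\<And>x y :: (real, 'n) vec. norm (trunc_drift \<alpha> U' n x - trunc_drift \<alpha> U' n y) \<le> \<Lambda> * norm (x - y)"
    using trunc_drift_lipschitz[OF \<alpha> lipschitz] by blast
  have "(\<lambda>m. t\<^sup>2 * \<Lambda>\<^sup>2 / 2 * inverse (real (Suc m))) \<longlonglongrightarrow> t\<^sup>2 * \<Lambda>\<^sup>2 / 2 * 0"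
    by (intro tendsto_intros LIMSEQ_inverse_real_of_nat)
  then have "(\<lambda>m. exp (c * t + t\<^sup>2 * \<Lambda>\<^sup>2 / 2 * inverse (real (Suc m)))) \<longlonglongrightarrow> exp (c * t + 0)"
    by (intro tendsto_intros) simp
  then have "\<forall>\<^sub>F m in sequentially. exp (c * t + t\<^sup>2 * \<Lambda>\<^sup>2 / 2 * inverse (real (Suc m))) < exp (c * t) + \<eta>"
    by (rule order_tendstoD(2)) (simp add: \<eta>)
  then show ?thesis
  proof (eventually_elim, intro allI impI)
    fix m :: nat and y y' :: "real \<Rightarrow> (real, 'n) vec"
    assume m: "exp (c * t + t\<^sup>2 * \<Lambda>\<^sup>2 / 2 * inverse (real (Suc m))) < exp (c * t) + \<eta>"
      and shift: "\<forall>s\<ge>0. y s - y' s = y 0 - y' 0"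
    let ?h = "t / real (Suc m)"
    have "norm (scheme n m t y - scheme n m t y')
        \<le> exp (?h * c + ?h\<^sup>2 * \<Lambda>\<^sup>2 / 2) ^ Suc m * norm (y 0 - y' 0)"
      unfolding scheme_def
    proof (rule euler_stable[OF \<Lambda>(2)])
      show "(u - v) \<bullet> (trunc_drift \<alpha> U' n u - trunc_drift \<alpha> U' n v) \<le> c * (norm (u - v))\<^sup>2"
        for u v :: "(real, 'n) vec"
        by (rule trunc_drift_one_sided[OF \<alpha> one_sided])
      show "y s - y' s = y 0 - y' 0" if "0 \<le> s" for s
        using shift that by blast
    qed (use t in simp)
    also have "exp (?h * c + ?h\<^sup>2 * \<Lambda>\<^sup>2 / 2) ^ Suc m = exp (real (Suc m) * (?h * c + ?h\<^sup>2 * \<Lambda>\<^sup>2 / 2))"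
      by (simp only: exp_of_nat_mult)
    also have "real (Suc m) * (?h * c + ?h\<^sup>2 * \<Lambda>\<^sup>2 / 2) = c * t + t\<^sup>2 * \<Lambda>\<^sup>2 / 2 * inverse (real (Suc m))"
      by (simp add: field_simps power2_eq_square del: of_nat_Suc)
    finally have "norm (scheme n m t y - scheme n m t y')
        \<le> exp (c * t + t\<^sup>2 * \<Lambda>\<^sup>2 / 2 * inverse (real (Suc m))) * norm (y 0 - y' 0)" .
    also have "\<dots> \<le> (exp (c * t) + \<eta>) * norm (y 0 - y' 0)"
      using m by (intro mult_right_mono) auto
    finally show "norm (scheme n m t y - scheme n m t y') \<le> (exp (c * t) + \<eta>) * norm (y 0 - y' 0)" .
  qed
qed

context
  fixes x y :: "real \<Rightarrow> real ^ 'n::{finite,linorder}"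
  assumes sol: "path_solution \<alpha> U' y x"
begin

lemma path_continuous: "continuous_on {0..t} x"
  using sol unfolding path_solution_def by (auto intro: continuous_on_subset)

lemma force_integrable: "i \<noteq> j \<Longrightarrow> 0 \<le> t \<Longrightarrow> set_integrable lborel {0..t} (\<lambda>s. V' \<alpha> (x s $ i - x s $ j))"
  using sol unfolding path_solution_def by auto

lemma drift_integrable:
  assumes "0 \<le> t"
  shows "set_integrable lborel {0..t} (\<lambda>s. drift \<alpha> U' (x s) i)"
proof -
  have "continuous_on {0..t} (\<lambda>s. U' (x s $ i))"
    by (rule continuous_on_compose2[OF U'_continuous])
      (auto intro!: continuous_intros path_continuous)
  then have "continuous_on {0..t} (\<lambda>s. - U' (x s $ i))"
    by (rule continuous_on_minus)
  then have "set_integrable lborel {0..t} (\<lambda>s. - U' (x s $ i))"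
    by (rule borel_integrable_atLeastAtMost')
  moreover have "set_integrable lborel {0..t} (\<lambda>s. \<Sum>j\<in>UNIV - {i}. V' \<alpha> (x s $ i - x s $ j))"
    using assms by (intro set_integrable_sum force_integrable) auto
  ultimately show ?thesis
    unfolding drift_def by (intro set_integral_diff(1) set_integrable_mult_right)
qed

lemma trunc_drift_integrable:
  "set_integrable lborel {0..t} (\<lambda>s. trunc_drift \<alpha> U' n (x s) $ i)"
proof (rule borel_integrable_atLeastAtMost')
  show "continuous_on {0..t} (\<lambda>s. trunc_drift \<alpha> U' n (x s) $ i)"
    by (intro continuous_intros continuous_on_compose2[OF trunc_drift_continuous path_continuous]) auto
qed

lemma path_start: "x 0 = y 0"
proof -
  have "(LINT s:{0..0}|lborel. drift \<alpha> U' (x s) i) = 0" for i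
    using set_borel_integral_eq_integral(2)[OF drift_integrable[of 0 i]] by simp
  with sol show ?thesis
    unfolding path_solution_def by (auto simp: vec_eq_iff)
qed

lemma path_increment:
  assumes "0 \<le> s" "s \<le> t"
  shows "x t $ i = x s $ i + (y t $ i - y s $ i) + integral {s..t} (\<lambda>r. drift \<alpha> U' (x r) i)"
proof -
  have eq: "x r $ i = y r $ i + integral {0..r} (\<lambda>r. drift \<alpha> U' (x r) i)" if "0 \<le> r" for r
    using sol that set_borel_integral_eq_integral(2)[OF drift_integrable[OF that, of i]]
    unfolding path_solution_def by auto
  have "integral {0..s} (\<lambda>r. drift \<alpha> U' (x r) i) + integral {s..t} (\<lambda>r. drift \<alpha> U' (x r) i)
      = integral {0..t} (\<lambda>r. drift \<alpha> U' (x r) i)"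
    using assms set_borel_integral_eq_integral(1)[OF drift_integrable]
    by (intro Henstock_Kurzweil_Integration.integral_combine) auto
  with eq[of s] eq[of t] assms show ?thesis by simp
qed

lemma trunc_error_integrable:
  assumes "0 \<le> t"
  shows "set_integrable lborel {0..t} (\<lambda>s. \<bar>drift \<alpha> U' (x s) i - trunc_drift \<alpha> U' n (x s) $ i\<bar>)"
  using assms
  by (intro set_integrable_abs set_integral_diff(1) drift_integrable trunc_drift_integrable)

text \<open>Dominated convergence in time: the path is ordered at almost every time, where the
  truncated forces are eventually exact, and the integrable singular forces dominate.\<close>

lemma trunc_error_tendsto_0:
  assumes t: "0 \<le> t"
  shows "(\<lambda>n. LINT s:{0..t}|lborel. \<bar>drift \<alpha> U' (x s) i - trunc_drift \<alpha> U' n (x s) $ i\<bar>) \<longlonglongrightarrow> 0"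
proof -
  let ?S = "\<lambda>n s. indicator {0..t} s *\<^sub>R \<bar>drift \<alpha> U' (x s) i - trunc_drift \<alpha> U' n (x s) $ i\<bar>"
  \<comment> \<open>\<open>U'\<close> cancels in the error, the factor 2 covers the singular and the
    truncated force together, and the prefactor 1/N is estimated by 1.\<close>
  let ?F = "\<lambda>s. 2 * (\<Sum>j\<in>UNIV - {i}. \<bar>V' \<alpha> (x s $ i - x s $ j)\<bar>)"
  have diff: "drift \<alpha> U' z i - trunc_drift \<alpha> U' n z $ i
      = - (1 / real CARD('n) * (\<Sum>j\<in>UNIV - {i}. V' \<alpha> (z $ i - z $ j) - trunc_pair \<alpha> n z i j))"
    for z :: "(real, 'n) vec" and n
  proof -
    have "(\<Sum>j\<in>UNIV. trunc_pair \<alpha> n z i j) = (\<Sum>j\<in>UNIV - {i}. trunc_pair \<alpha> n z i j)"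
      by (intro sum.mono_neutral_right) (auto simp: trunc_pair_def)
    then show ?thesis
      by (simp add: drift_def trunc_drift_def sum_subtractf diff_divide_distrib)
  qed
  have ord: "AE s in lborel. 0 \<le> s \<longrightarrow> x s \<in> ordered_configs"
    using sol unfolding path_solution_def by simp
  have "(\<lambda>n. integral\<^sup>L lborel (?S n)) \<longlonglongrightarrow> integral\<^sup>L lborel (\<lambda>_ :: real. 0)"
  proof (rule integral_dominated_convergence[where w = "\<lambda>s. indicator {0..t} s *\<^sub>R ?F s"])
    show "?S n \<in> borel_measurable lborel" for n
      using trunc_error_integrable[OF t, of i n] unfolding set_integrable_def by auto
    show "integrable lborel (\<lambda>s. indicator {0..t} s *\<^sub>R ?F s)"
      unfolding set_integrable_def[symmetric] using t
      by (intro set_integrable_mult_right set_integrable_sum set_integrable_abs force_integrable) auto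
    show "AE s in lborel. (\<lambda>n. ?S n s) \<longlonglongrightarrow> 0"
      using ord
    proof eventually_elim
      case (elim s)
      show ?case
      proof (cases "s \<in> {0..t}")
        case True
        have "\<forall>\<^sub>F n in sequentially. \<forall>j\<in>UNIV - {i}.
            trunc_pair \<alpha> n (x s) i j = V' \<alpha> (x s $ i - x s $ j)"
          using elim True by (intro eventually_ball_finite ballI trunc_pair_bound(2)[OF \<alpha>]) auto
        then have "\<forall>\<^sub>F n in sequentially. ?S n s = 0"
          by eventually_elim (simp add: diff)
        then show ?thesis by (rule tendsto_eventually)
      qed simp
    qed
    show "AE s in lborel. norm (?S n s) \<le> indicator {0..t} s *\<^sub>R ?F s" for n
      using ord
    proof eventually_elim
      case (elim s)
      show ?case
      proof (cases "s \<in> {0..t}")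
        case True
        have "\<bar>drift \<alpha> U' (x s) i - trunc_drift \<alpha> U' n (x s) $ i\<bar>
            \<le> 1 * \<bar>\<Sum>j\<in>UNIV - {i}. V' \<alpha> (x s $ i - x s $ j) - trunc_pair \<alpha> n (x s) i j\<bar>"
          unfolding diff abs_minus_cancel abs_mult by (intro mult_right_mono) auto
        also have "\<dots> \<le> (\<Sum>j\<in>UNIV - {i}. \<bar>V' \<alpha> (x s $ i - x s $ j) - trunc_pair \<alpha> n (x s) i j\<bar>)"
          by simp
        also have "\<dots> \<le> (\<Sum>j\<in>UNIV - {i}. 2 * \<bar>V' \<alpha> (x s $ i - x s $ j)\<bar>)"
        proof (rule sum_mono)
          fix j assume "j \<in> UNIV - {i}"
          then have "\<bar>trunc_pair \<alpha> n (x s) i j\<bar> \<le> \<bar>V' \<alpha> (x s $ i - x s $ j)\<bar>"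
            using elim True by (intro trunc_pair_bound(1)[OF \<alpha>]) auto
          then show "\<bar>V' \<alpha> (x s $ i - x s $ j) - trunc_pair \<alpha> n (x s) i j\<bar>
              \<le> 2 * \<bar>V' \<alpha> (x s $ i - x s $ j)\<bar>"
            by linarith
        qed
        finally show ?thesis using True by (simp add: sum_distrib_left)
      qed simp
    qed
  qed simp
  then show ?thesis by (simp add: set_lebesgue_integral_def)
qed

text \<open>The exact path satisfies the recursion up to a defect with two parts: the time integral
  of the truncation error, which adds up over the grid to the integral over [0, t], and the freezing
  of the truncated drift at the left end point, which costs at most h \<Lambda> \<delta> per step
  and coordinate.\<close>

lemma scheme_error_bound:
  fixes n m :: nat
  assumes t: "0 \<le> t" and \<Lambda>: "0 \<le> \<Lambda>"
    and lip: "\<And>u v :: (real, 'n) vec. norm (trunc_drift \<alpha> U' n u - trunc_drift \<alpha> U' n v) \<le> \<Lambda> * norm (u - v)"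
    and \<delta>: "\<And>r s. 0 \<le> r \<Longrightarrow> r \<le> s \<Longrightarrow> s \<le> t \<Longrightarrow> s - r \<le> t / real (Suc m) \<Longrightarrow> norm (x s - x r) \<le> \<delta>"
  shows "norm (x t - scheme n m t y)
    \<le> exp (t * \<bar>c\<bar> + t\<^sup>2 * \<Lambda>\<^sup>2 / 2 * inverse (real (Suc m)))
      * ((\<Sum>i\<in>UNIV. LINT s:{0..t}|lborel. \<bar>drift \<alpha> U' (x s) i - trunc_drift \<alpha> U' n (x s) $ i\<bar>)
         + real CARD('n) * (t * (\<Lambda> * \<delta>)))"
proof -
  define h where "h = t / real (Suc m)"
  define b where "b = (trunc_drift \<alpha> U' n :: (real, 'n) vec \<Rightarrow> _)"
  define D where "D i = (\<lambda>s. drift \<alpha> U' (x s) i)" for i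
  define g where "g i = (\<lambda>s. \<bar>D i s - b (x s) $ i\<bar>)" for i
  define r where "r k = x (real (Suc k) * h) - x (real k * h)
      - (y (real (Suc k) * h) - y (real k * h)) - h *\<^sub>R b (x (real k * h))" for k
  have h: "0 \<le> h" "real (Suc m) * h = t"
    using t by (simp_all add: h_def)
  have grid: "0 \<le> real k * h" "real k * h \<le> real (Suc k) * h" for k
    using h by (auto intro: mult_right_mono)
  have grid_le: "real (Suc k) * h \<le> t" if "k < Suc m" for k
    unfolding h(2)[symmetric] using that h(1) by (intro mult_right_mono) auto
  have D_int: "D i integrable_on {r..s}" if "0 \<le> r" "r \<le> s" for i r s
  proof (rule integrable_on_subinterval)
    show "D i integrable_on {0..s}"
      unfolding D_def using that by (intro set_borel_integral_eq_integral(1) drift_integrable) simp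
  qed (use that in simp)
  have g_int: "g i integrable_on {r..s}" if "0 \<le> r" "r \<le> s" for i r s
  proof (rule integrable_on_subinterval)
    show "g i integrable_on {0..s}"
      unfolding g_def D_def b_def using that
      by (intro set_borel_integral_eq_integral(1) trunc_error_integrable) simp
  qed (use that in simp)
  have r_bound: "\<bar>r k $ i\<bar> \<le> integral {real k * h..real (Suc k) * h} (g i) + h * (\<Lambda> * \<delta>)"
    if k: "k < Suc m" for k i
  proof -
    let ?s = "real k * h" and ?s' = "real (Suc k) * h"
    have len: "?s' - ?s = h" by (simp add: algebra_simps)
    have "r k $ i = integral {?s..?s'} (D i) - h * b (x ?s) $ i"
      using path_increment[OF grid, of k i] by (simp add: r_def D_def)
    also have "\<dots> = integral {?s..?s'} (\<lambda>q. D i q - b (x ?s) $ i)"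
      using D_int[OF grid] grid[of k] len
      by (subst Henstock_Kurzweil_Integration.integral_diff) auto
    also have "\<bar>\<dots>\<bar> \<le> integral {?s..?s'} (\<lambda>q. g i q + \<Lambda> * \<delta>)"
    proof (rule integral_norm_bound_integral[where 'a=real, unfolded real_norm_def])
      show "(\<lambda>q. D i q - b (x ?s) $ i) integrable_on {?s..?s'}"
        using D_int[OF grid] by (intro integrable_diff) auto
      show "(\<lambda>q. g i q + \<Lambda> * \<delta>) integrable_on {?s..?s'}"
        using g_int[OF grid] by (intro integrable_add) auto
      fix q assume q: "q \<in> {?s..?s'}"
      have "norm (x q - x ?s) \<le> \<delta>"
        using q grid[of k] grid_le[OF k] len by (intro \<delta>) (auto simp: h_def[symmetric] simp del: of_nat_Suc)
      then have "\<Lambda> * norm (x q - x ?s) \<le> \<Lambda> * \<delta>"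
        using \<Lambda> by (intro mult_left_mono)
      moreover have "\<bar>b (x q) $ i - b (x ?s) $ i\<bar> \<le> norm (b (x q) - b (x ?s))"
        using component_le_norm_cart[of "b (x q) - b (x ?s)" i] by simp
      ultimately show "\<bar>D i q - b (x ?s) $ i\<bar> \<le> g i q + \<Lambda> * \<delta>"
        using lip[of "x q" "x ?s"] unfolding g_def b_def by linarith
    qed
    also have "\<dots> = integral {?s..?s'} (g i) + h * (\<Lambda> * \<delta>)"
      using g_int[OF grid] grid[of k] len
      by (subst Henstock_Kurzweil_Integration.integral_add) auto
    finally show ?thesis .
  qed
  \<comment> \<open>The l1 norm makes the coordinatewise bound applicable and produces the factor N
    in front of the freezing error.\<close>
  have "(\<Sum>k<Suc m. norm (r k)) \<le> (\<Sum>k<Suc m. \<Sum>i\<in>UNIV. \<bar>r k $ i\<bar>)"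
    by (intro sum_mono norm_le_l1_cart)
  also have "\<dots> \<le> (\<Sum>k<Suc m. \<Sum>i\<in>UNIV. integral {real k * h..real (Suc k) * h} (g i) + h * (\<Lambda> * \<delta>))"
    by (intro sum_mono r_bound) auto
  also have "\<dots> = (\<Sum>i\<in>UNIV. \<Sum>k<Suc m. integral {real k * h..real (Suc k) * h} (g i) + h * (\<Lambda> * \<delta>))"
    by (rule sum.swap)
  also have "\<dots> = (\<Sum>i\<in>UNIV. integral {0..t} (g i) + t * (\<Lambda> * \<delta>))"
  proof (rule sum.cong[OF refl])
    fix i
    have "(\<Sum>k<Suc m. integral {real k * h..real (Suc k) * h} (g i)) = integral {0..t} (g i)"
      using sum_integral_grid[OF h(1), of "g i" "Suc m"] g_int[of 0 t i] t unfolding h(2) by simp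
    then show "(\<Sum>k<Suc m. integral {real k * h..real (Suc k) * h} (g i) + h * (\<Lambda> * \<delta>))
        = integral {0..t} (g i) + t * (\<Lambda> * \<delta>)"
      by (simp only: sum.distrib sum_constant card_lessThan mult.assoc[symmetric] h(2))
  qed
  also have "\<dots> = (\<Sum>i\<in>UNIV. integral {0..t} (g i)) + real CARD('n) * (t * (\<Lambda> * \<delta>))"
    by (simp add: sum.distrib)
  also have "(\<Sum>i\<in>UNIV. integral {0..t} (g i))
      = (\<Sum>i\<in>UNIV. LINT s:{0..t}|lborel. \<bar>drift \<alpha> U' (x s) i - trunc_drift \<alpha> U' n (x s) $ i\<bar>)"
    using set_borel_integral_eq_integral(2)[OF trunc_error_integrable[OF t]]
    by (simp add: g_def D_def b_def)
  finally have sum_r: "(\<Sum>k<Suc m. norm (r k))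
    \<le> (\<Sum>i\<in>UNIV. LINT s:{0..t}|lborel. \<bar>drift \<alpha> U' (x s) i - trunc_drift \<alpha> U' n (x s) $ i\<bar>)
      + real CARD('n) * (t * (\<Lambda> * \<delta>))" .
  \<comment> \<open>The consistency estimate wants a nonnegative constant, hence |c|. Sharpness does
    not matter here, because the sum of the defects tends to 0.\<close>
  have "norm (x (real (Suc m) * h) - euler b h y (Suc m))
      \<le> exp (h * \<bar>c\<bar> + h\<^sup>2 * \<Lambda>\<^sup>2 / 2) ^ Suc m * (\<Sum>k<Suc m. norm (r k))"
  proof (rule euler_consistent[where m = "Suc m"])
    show "norm (b u - b v) \<le> \<Lambda> * norm (u - v)" for u v
      unfolding b_def by (rule lip)
    show "(u - v) \<bullet> (b u - b v) \<le> \<bar>c\<bar> * (norm (u - v))\<^sup>2" for u v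
    proof -
      have "c * (norm (u - v))\<^sup>2 \<le> \<bar>c\<bar> * (norm (u - v))\<^sup>2"
        by (intro mult_right_mono) auto
      with trunc_drift_one_sided[where U'=U' and n=n and c=c, OF \<alpha> one_sided, of u v] show ?thesis
        unfolding b_def by linarith
    qed
    show "x (real (Suc k) * h) = x (real k * h)
        + (y (real (Suc k) * h) - y (real k * h)) + h *\<^sub>R b (x (real k * h)) + r k" for k
      by (simp add: r_def)
  qed (use h path_start in auto)
  also have "exp (h * \<bar>c\<bar> + h\<^sup>2 * \<Lambda>\<^sup>2 / 2) ^ Suc m
      = exp (real (Suc m) * (h * \<bar>c\<bar> + h\<^sup>2 * \<Lambda>\<^sup>2 / 2))"
    by (simp only: exp_of_nat_mult)
  also have "real (Suc m) * (h * \<bar>c\<bar> + h\<^sup>2 * \<Lambda>\<^sup>2 / 2)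
      = t * \<bar>c\<bar> + t\<^sup>2 * \<Lambda>\<^sup>2 / 2 * inverse (real (Suc m))"
    unfolding h_def by (simp add: field_simps power2_eq_square del: of_nat_Suc)
  finally have "norm (x t - scheme n m t y)
      \<le> exp (t * \<bar>c\<bar> + t\<^sup>2 * \<Lambda>\<^sup>2 / 2 * inverse (real (Suc m))) * (\<Sum>k<Suc m. norm (r k))"
    unfolding h(2) unfolding scheme_def b_def h_def .
  also have "\<dots> \<le> exp (t * \<bar>c\<bar> + t\<^sup>2 * \<Lambda>\<^sup>2 / 2 * inverse (real (Suc m)))
      * ((\<Sum>i\<in>UNIV. LINT s:{0..t}|lborel. \<bar>drift \<alpha> U' (x s) i - trunc_drift \<alpha> U' n (x s) $ i\<bar>)
      + real CARD('n) * (t * (\<Lambda> * \<delta>)))"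
    using sum_r by (intro mult_left_mono) auto
  finally show ?thesis .
qed

text \<open>The order of the choices is forced: \<open>n\<close> makes the truncation error small,
  this fixes \<Lambda>, and only then do \<Lambda> and the uniform continuity of the path on [0, t]
  determine how fine the grid must be.\<close>

lemma scheme_converges:
  assumes t: "0 \<le> t" and \<epsilon>: "0 < \<epsilon>"
  shows "\<forall>\<^sub>F n in sequentially. \<forall>\<^sub>F m in sequentially. norm (x t - scheme n m t y) < \<epsilon>"
proof -
  \<comment> \<open>The summand 1 absorbs the term t^2 \<Lambda>^2 / (2 (m + 1)), which is
    eventually below 1.\<close>
  define E where "E = exp (t * \<bar>c\<bar> + 1)"
  define J where "J n = (\<Sum>i\<in>UNIV. LINT s:{0..t}|lborel.
      \<bar>drift \<alpha> U' (x s) i - trunc_drift \<alpha> U' n (x s) $ i\<bar>)" for n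
  have E: "E > 0" by (simp add: E_def)
  have "(\<lambda>n. E * J n) \<longlonglongrightarrow> E * (\<Sum>i\<in>(UNIV :: 'n set). 0)"
    unfolding J_def by (intro tendsto_intros trunc_error_tendsto_0 t)
  then have "\<forall>\<^sub>F n in sequentially. E * J n < \<epsilon> / 2"
    by (rule order_tendstoD(2)) (simp add: \<epsilon>)
  then show ?thesis
  proof eventually_elim
    fix n assume n: "E * J n < \<epsilon> / 2"
    obtain \<Lambda> where \<Lambda>: "0 \<le> \<Lambda>"
      "\<And>x y :: (real, 'n) vec. norm (trunc_drift \<alpha> U' n x - trunc_drift \<alpha> U' n y) \<le> \<Lambda> * norm (x - y)"
      using trunc_drift_lipschitz[OF \<alpha> lipschitz] by blast
    define a where "a = E * (real CARD('n) * (t * \<Lambda>))"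
    \<comment> \<open>Adding 1 to \<open>a\<close> covers the case a = 0, for instance t = 0, and
      makes a \<delta> < \<epsilon> / 2 strict.\<close>
    define \<delta> where "\<delta> = \<epsilon> / (2 * (a + 1))"
    have a: "0 \<le> a" using E t \<Lambda> by (simp add: a_def)
    have \<delta>: "0 < \<delta>" "a * \<delta> < \<epsilon> / 2"
      using a \<epsilon> by (auto simp: \<delta>_def field_simps)
    have "uniformly_continuous_on {0..t} x"
      by (intro compact_uniformly_continuous path_continuous) auto
    then obtain \<rho> where \<rho>: "\<rho> > 0"
      "\<And>r s. r \<in> {0..t} \<Longrightarrow> s \<in> {0..t} \<Longrightarrow> dist s r < \<rho> \<Longrightarrow> dist (x s) (x r) < \<delta>"
      unfolding uniformly_continuous_on_def using \<delta>(1) by metis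
    have "(\<lambda>m. t * inverse (real (Suc m))) \<longlonglongrightarrow> t * 0"
      by (intro tendsto_intros LIMSEQ_inverse_real_of_nat)
    then have ev1: "\<forall>\<^sub>F m in sequentially. t * inverse (real (Suc m)) < \<rho>"
      by (rule order_tendstoD(2)) (simp add: \<rho>(1))
    have "(\<lambda>m. t\<^sup>2 * \<Lambda>\<^sup>2 / 2 * inverse (real (Suc m))) \<longlonglongrightarrow> t\<^sup>2 * \<Lambda>\<^sup>2 / 2 * 0"
      by (intro tendsto_intros LIMSEQ_inverse_real_of_nat)
    then have ev2: "\<forall>\<^sub>F m in sequentially. t\<^sup>2 * \<Lambda>\<^sup>2 / 2 * inverse (real (Suc m)) < 1"
      by (rule order_tendstoD(2)) simp
    show "\<forall>\<^sub>F m in sequentially. norm (x t - scheme n m t y) < \<epsilon>"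
      using ev1 ev2
    proof eventually_elim
      fix m assume m: "t * inverse (real (Suc m)) < \<rho>" "t\<^sup>2 * \<Lambda>\<^sup>2 / 2 * inverse (real (Suc m)) < 1"
      have mod: "norm (x s - x r) \<le> \<delta>"
        if "0 \<le> r" "r \<le> s" "s \<le> t" "s - r \<le> t / real (Suc m)" for r s
        using \<rho>(2)[of r s] that m(1) by (auto simp: dist_norm divide_inverse)
      have J0: "0 \<le> J n"
        unfolding J_def set_lebesgue_integral_def by (intro sum_nonneg integral_nonneg) auto
      have "norm (x t - scheme n m t y)
        \<le> exp (t * \<bar>c\<bar> + t\<^sup>2 * \<Lambda>\<^sup>2 / 2 * inverse (real (Suc m))) * (J n + real CARD('n) * (t * (\<Lambda> * \<delta>)))"
        using scheme_error_bound[OF t \<Lambda> mod] unfolding J_def .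
      also have "\<dots> \<le> E * (J n + real CARD('n) * (t * (\<Lambda> * \<delta>)))"
        using m(2) J0 t \<Lambda>(1) \<delta>(1) unfolding E_def by (intro mult_right_mono) auto
      also have "\<dots> = E * J n + a * \<delta>"
        by (simp add: a_def algebra_simps)
      also have "\<dots> < \<epsilon>" using n \<delta>(2) by simp
      finally show "norm (x t - scheme n m t y) < \<epsilon>" .
    qed
  qed
qed

end

text \<open>Both solutions are limits of the same schemes, and one pair (n, m) can serve the two
  convergences and the stability bound at once.\<close>

lemma path_solution_stable:
  fixes x x' y y' :: "real \<Rightarrow> real ^ 'n::{finite,linorder}"
  assumes sol: "path_solution \<alpha> U' y x" "path_solution \<alpha> U' y' x'"
    and shift: "\<forall>s\<ge>0. y s - y' s = y 0 - y' 0" and t: "0 \<le> t"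
  shows "norm (x t - x' t) \<le> exp (c * t) * norm (x 0 - x' 0)"
proof (rule field_le_epsilon)
  fix e :: real assume e: "0 < e"
  let ?d = "norm (x 0 - x' 0)"
  \<comment> \<open>The budget is one \<epsilon> for each of the two approximations and \<epsilon>
    times the initial distance for the excess in the stability constant.\<close>
  define \<epsilon> where "\<epsilon> = e / (?d + 2)"
  have d2: "?d + 2 > 0" by (simp add: add_nonneg_pos)
  then have \<epsilon>: "0 < \<epsilon>" "\<epsilon> * (?d + 2) = e"
    using e by (simp_all add: \<epsilon>_def)
  have "\<forall>\<^sub>F n in sequentially. \<exists>m. norm (x t - scheme n m t y) < \<epsilon> \<and> norm (x' t - scheme n m t y') < \<epsilon>
      \<and> norm (scheme n m t y - scheme n m t y') \<le> (exp (c * t) + \<epsilon>) * norm (y 0 - y' 0)"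
    using scheme_converges[OF sol(1) t \<epsilon>(1)] scheme_converges[OF sol(2) t \<epsilon>(1)]
  proof eventually_elim
    case (elim n)
    then have "\<forall>\<^sub>F m in sequentially. norm (x t - scheme n m t y) < \<epsilon> \<and> norm (x' t - scheme n m t y') < \<epsilon>
      \<and> norm (scheme n m t y - scheme n m t y') \<le> (exp (c * t) + \<epsilon>) * norm (y 0 - y' 0)"
      using scheme_stable[OF t \<epsilon>(1), of n]
      by eventually_elim (use shift in blast)
    then show ?case by (rule eventually_happens'[OF sequentially_bot])
  qed
  from eventually_happens'[OF sequentially_bot this]
  obtain n m where nm: "norm (x t - scheme n m t y) < \<epsilon>" "norm (x' t - scheme n m t y') < \<epsilon>"
    "norm (scheme n m t y - scheme n m t y') \<le> (exp (c * t) + \<epsilon>) * ?d"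
    unfolding path_start[OF sol(1)] path_start[OF sol(2)] by blast
  have "norm (x t - x' t) \<le> norm (x t - scheme n m t y) + norm (scheme n m t y - scheme n m t y')
      + norm (x' t - scheme n m t y')"
    using dist_triangle[of "x t" "x' t" "scheme n m t y"]
      dist_triangle2[of "scheme n m t y" "x' t" "scheme n m t y'"]
    unfolding dist_norm by linarith
  also have "\<dots> \<le> exp (c * t) * ?d + \<epsilon> * (?d + 2)"
    using nm by (simp add: algebra_simps)
  finally show "norm (x t - x' t) \<le> exp (c * t) * ?d + e"
    by (simp add: \<epsilon>(2))
qed

end

section \<open>Iterated limits in measure\<close>

lemma (in finite_measure) AE_eventually_notin_imp_measure_tendsto_0:
  fixes A :: "nat \<Rightarrow> 'a set"
  assumes A[measurable]: "\<And>n. A n \<in> sets M"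
    and ae: "AE \<omega> in M. \<forall>\<^sub>F n in sequentially. \<omega> \<notin> A n"
  shows "(\<lambda>n. measure M (A n)) \<longlonglongrightarrow> 0"
proof -
  have "(\<lambda>n. integral\<^sup>L M (indicat_real (A n))) \<longlonglongrightarrow> integral\<^sup>L M (\<lambda>_. 0)"
  proof (rule integral_dominated_convergence[where w = "\<lambda>_. 1"])
    show "AE \<omega> in M. (\<lambda>n. indicat_real (A n) \<omega>) \<longlonglongrightarrow> 0"
      using ae
    proof eventually_elim
      case (elim \<omega>)
      then have "\<forall>\<^sub>F n in sequentially. indicat_real (A n) \<omega> = 0"
        by eventually_elim simp
      then show ?case by (rule tendsto_eventually)
    qed
  qed (auto simp: indicator_def)
  then show ?thesis by simp
qed

text \<open>Pathwise, the thresholds for \<open>n\<close> and \<open>m\<close> depend on the sample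
  point; in measure they become deterministic. The set \<open>C n\<close> collects the points where
  the inner statement fails for \<open>n\<close>. Its measure tends to 0, and for fixed
  \<open>n\<close> every point outside \<open>C n\<close> leaves \<open>A n m\<close> for large
  \<open>m\<close>.\<close>

lemma (in finite_measure) iterated_limit_in_measure:
  fixes f :: "nat \<Rightarrow> nat \<Rightarrow> 'a \<Rightarrow> real"
  assumes f[measurable]: "\<And>n m. f n m \<in> borel_measurable M"
    and ae: "AE \<omega> in M. \<forall>\<^sub>F n in sequentially. \<forall>\<^sub>F m in sequentially. f n m \<omega> < \<epsilon>"
    and \<eta>: "0 < \<eta>"
  shows "\<forall>\<^sub>F n in sequentially. \<forall>\<^sub>F m in sequentially.
    measure M {\<omega> \<in> space M. \<epsilon> \<le> f n m \<omega>} < \<eta>"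
proof -
  define A where "A n m = {\<omega> \<in> space M. \<epsilon> \<le> f n m \<omega>}" for n m
  define C where "C n = {\<omega> \<in> space M. \<not> (\<forall>\<^sub>F m in sequentially. f n m \<omega> < \<epsilon>)}" for n
  have [measurable]: "A n m \<in> sets M" "C n \<in> sets M" for n m
    unfolding A_def C_def eventually_sequentially by measurable
  have "AE \<omega> in M. \<forall>\<^sub>F n in sequentially. \<omega> \<notin> C n"
    using ae by eventually_elim (auto simp: C_def elim: eventually_mono)
  then have "(\<lambda>n. measure M (C n)) \<longlonglongrightarrow> 0"
    by (intro AE_eventually_notin_imp_measure_tendsto_0) auto
  then have "\<forall>\<^sub>F n in sequentially. measure M (C n) < \<eta> / 2"
    by (rule order_tendstoD(2)) (simp add: \<eta>)
  then show ?thesis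
  proof eventually_elim
    case (elim n)
    have "AE \<omega> in M. \<forall>\<^sub>F m in sequentially. \<omega> \<notin> A n m - C n"
    proof (rule AE_I2)
      fix \<omega> assume \<omega>: "\<omega> \<in> space M"
      show "\<forall>\<^sub>F m in sequentially. \<omega> \<notin> A n m - C n"
      proof (cases "\<omega> \<in> C n")
        case False
        then have "\<forall>\<^sub>F m in sequentially. f n m \<omega> < \<epsilon>"
          using \<omega> by (simp add: C_def)
        then show ?thesis by eventually_elim (simp add: A_def)
      qed simp
    qed
    then have "(\<lambda>m. measure M (A n m - C n)) \<longlonglongrightarrow> 0"
      by (intro AE_eventually_notin_imp_measure_tendsto_0) auto
    then have "\<forall>\<^sub>F m in sequentially. measure M (A n m - C n) < \<eta> / 2"
      by (rule order_tendstoD(2)) (simp add: \<eta>)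
    then show ?case
    proof eventually_elim
      case (elim m)
      have "measure M (A n m) \<le> measure M ((A n m - C n) \<union> C n)"
        by (intro finite_measure_mono) auto
      also have "\<dots> \<le> measure M (A n m - C n) + measure M (C n)"
        by (intro measure_subadditive) auto
      finally show ?case
        using elim \<open>measure M (C n) < \<eta> / 2\<close> unfolding A_def by simp
    qed
  qed
qed

text \<open>Borel-Cantelli: the measures of the exceptional sets are summable, so almost every point
  eventually has g_k \<le> (1/2)^k.\<close>

lemma (in finite_measure) AE_tendsto_0_of_fast_convergence:
  fixes g :: "nat \<Rightarrow> 'a \<Rightarrow> real"
  assumes g[measurable]: "\<And>k. g k \<in> borel_measurable M"
    and nonneg: "\<And>k \<omega>. 0 \<le> g k \<omega>"
    and fast: "\<And>k. measure M {\<omega> \<in> space M. (1/2) ^ k \<le> g k \<omega>} \<le> (1/2) ^ k"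
  shows "AE \<omega> in M. (\<lambda>k. g k \<omega>) \<longlonglongrightarrow> 0"
proof -
  let ?A = "\<lambda>k. {\<omega> \<in> space M. (1/2) ^ k \<le> g k \<omega>}"
  have "AE \<omega> in M. \<forall>\<^sub>F k in sequentially. \<omega> \<in> space M - ?A k"
  proof (rule borel_cantelli_AE1)
    show "summable (\<lambda>k. measure M (?A k))"
      by (rule summable_comparison_test'[where g = "\<lambda>k. (1/2) ^ k" and N = 0])
        (use fast in \<open>auto intro: summable_geometric\<close>)
  qed (auto simp: less_top[symmetric])
  then show ?thesis
  proof eventually_elim
    case (elim \<omega>)
    then have bound: "\<forall>\<^sub>F k in sequentially. g k \<omega> \<le> (1/2) ^ k"
      by eventually_elim auto
    have "(\<lambda>k. (1/2 :: real) ^ k) \<longlonglongrightarrow> 0"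
      by (intro LIMSEQ_realpow_zero) auto
    with bound show ?case
      by (intro tendsto_sandwich[OF always_eventually bound tendsto_const]) (simp_all add: nonneg)
  qed
qed

section \<open>Laws of processes with independent increments\<close>

abbreviation path_algebra :: "(real \<Rightarrow> 'v::topological_space) measure" where
  "path_algebra \<equiv> \<Pi>\<^sub>M s\<in>{0..}. borel"

definition path_law :: "'a measure \<Rightarrow> (real \<Rightarrow> 'a \<Rightarrow> 'v::topological_space) \<Rightarrow> (real \<Rightarrow> 'v) measure" where
  "path_law M Y = distr M path_algebra (\<lambda>\<omega>. \<lambda>s\<in>{0..}. Y s \<omega>)"

text \<open>\<open>D d\<close> is the law of the increments over time intervals of length \<open>d\<close>.\<close>

definition has_indep_increments ::
    "'a measure \<Rightarrow> (real \<Rightarrow> 'v measure) \<Rightarrow> (real \<Rightarrow> 'a \<Rightarrow> 'v::euclidean_space) \<Rightarrow> bool" where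
  "has_indep_increments M D Y \<longleftrightarrow>
     (\<forall>s\<ge>0. Y s \<in> borel_measurable M) \<and>
     (\<forall>J s t A C. finite J \<and> J \<subseteq> {0..s} \<and> 0 \<le> s \<and> s < t \<and>
        A \<in> sets (\<Pi>\<^sub>M j\<in>J. borel) \<and> C \<in> sets borel \<longrightarrow>
        emeasure M {\<omega> \<in> space M. (\<lambda>j\<in>J. Y j \<omega>) \<in> A \<and> Y t \<omega> - Y s \<omega> \<in> C}
          = emeasure M {\<omega> \<in> space M. (\<lambda>j\<in>J. Y j \<omega>) \<in> A} * emeasure (D (t - s)) C)"

lemma has_indep_incrementsD:
  assumes "has_indep_increments M D Y" "finite J" "J \<subseteq> {0..s}" "0 \<le> s" "s < t"
    "A \<in> sets (\<Pi>\<^sub>M j\<in>J. borel)" "C \<in> sets borel"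
  shows "emeasure M {\<omega> \<in> space M. (\<lambda>j\<in>J. Y j \<omega>) \<in> A \<and> Y t \<omega> - Y s \<omega> \<in> C}
      = emeasure M {\<omega> \<in> space M. (\<lambda>j\<in>J. Y j \<omega>) \<in> A} * emeasure (D (t - s)) C"
  using assms(1)[unfolded has_indep_increments_def, THEN conjunct2, rule_format, of J s t A C] assms(2-)
  by simp

text \<open>Induction on the latest time: the law at the enlarged time set is the image of a
  product, the law of the earlier values times the law of the next increment, so the initial law and
  \<open>D\<close> determine it. Time 0 belongs to every index set, so that an earlier time is
  always available.\<close>

lemma finite_dim_law_unique:
  fixes Y :: "real \<Rightarrow> 'a \<Rightarrow> 'v::euclidean_space" and Y' :: "real \<Rightarrow> 'b \<Rightarrow> 'v"
  assumes "prob_space M" "prob_space M'"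
    and D: "\<And>d. 0 < d \<Longrightarrow> prob_space (D d)" "\<And>d. sets (D d) = sets borel"
    and Y: "has_indep_increments M D Y" and Y': "has_indep_increments M' D Y'"
    and start: "distr M borel (Y 0) = distr M' borel (Y' 0)"
    and J: "finite J" "J \<subseteq> {0<..}"
  shows "distr M (\<Pi>\<^sub>M j\<in>insert 0 J. borel) (\<lambda>\<omega>. \<lambda>j\<in>insert 0 J. Y j \<omega>)
    = distr M' (\<Pi>\<^sub>M j\<in>insert 0 J. borel) (\<lambda>\<omega>. \<lambda>j\<in>insert 0 J. Y' j \<omega>)"
  using J
proof (induction J rule: finite_linorder_max_induct)
  case empty
  have *: "distr N (\<Pi>\<^sub>M j\<in>{0}. borel) (\<lambda>\<omega>. \<lambda>j\<in>{0}. Z j \<omega>)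
      = distr (distr N borel (Z 0)) (\<Pi>\<^sub>M j\<in>{0}. borel) (\<lambda>v. \<lambda>j\<in>{0}. v)"
    if "has_indep_increments N D Z" for N :: "'c measure" and Z :: "real \<Rightarrow> 'c \<Rightarrow> 'v"
  proof -
    have [measurable]: "Z 0 \<in> borel_measurable N"
      using that by (simp add: has_indep_increments_def)
    show ?thesis
      by (subst distr_distr) (auto simp: comp_def intro!: distr_cong)
  qed
  show ?case using *[OF Y] *[OF Y'] start by (simp only:)
next
  case (insert b J)
  define I where "I = insert 0 J"
  define s where "s = Max I"
  have I: "finite I" "s \<in> I" "I \<subseteq> {0..s}" "0 \<le> s" "s < b" "b \<notin> I"
  proof -
    show "finite I" using insert by (simp add: I_def)
    then show "s \<in> I" unfolding s_def by (intro Max_in) (simp_all add: I_def)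
    then show "s < b" "0 \<le> s" using insert by (auto simp: I_def)
    show "I \<subseteq> {0..s}" using \<open>finite I\<close> insert.prems unfolding s_def by (auto simp: I_def)
    show "b \<notin> I" using insert by (auto simp: I_def)
  qed
  \<comment> \<open>Rebuilds the value at the new time \<open>b\<close> as the value at the last
    earlier time \<open>s\<close> plus an increment.\<close>
  define g :: "(real \<Rightarrow> 'v) \<times> 'v \<Rightarrow> real \<Rightarrow> 'v"
    where "g = (\<lambda>(v, d). \<lambda>j\<in>insert b I. if j = b then v s + d else v j)"
  have [measurable]: "g \<in> (\<Pi>\<^sub>M j\<in>I. borel) \<Otimes>\<^sub>M borel \<rightarrow>\<^sub>M (\<Pi>\<^sub>M j\<in>insert b I. borel)"
    unfolding g_def case_prod_beta using I(2)
    by (intro measurable_restrict) (auto intro!: borel_measurable_add)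
  have *: "distr N (\<Pi>\<^sub>M j\<in>insert b I. borel) (\<lambda>\<omega>. \<lambda>j\<in>insert b I. Z j \<omega>)
      = distr (distr N (\<Pi>\<^sub>M j\<in>I. borel) (\<lambda>\<omega>. \<lambda>j\<in>I. Z j \<omega>) \<Otimes>\<^sub>M D (b - s)) (\<Pi>\<^sub>M j\<in>insert b I. borel) g"
    if N: "prob_space N" and Z: "has_indep_increments N D Z" for N :: "'c measure" and Z :: "real \<Rightarrow> 'c \<Rightarrow> 'v"
  proof -
    interpret N: prob_space N by fact
    interpret D: prob_space "D (b - s)" using D(1) I by simp
    have Z_meas: "Z j \<in> borel_measurable N" if "j \<in> insert b I" for j
      using that I Z by (auto simp: has_indep_increments_def subset_eq)
    then have [measurable]: "Z b \<in> borel_measurable N" "Z s \<in> borel_measurable N"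
      "(\<lambda>\<omega>. \<lambda>j\<in>I. Z j \<omega>) \<in> N \<rightarrow>\<^sub>M (\<Pi>\<^sub>M j\<in>I. borel)"
      using I(2) by (auto intro!: measurable_restrict)
    interpret L: prob_space "distr N (\<Pi>\<^sub>M j\<in>I. borel) (\<lambda>\<omega>. \<lambda>j\<in>I. Z j \<omega>)"
      by (rule N.prob_space_distr) simp
    \<comment> \<open>On rectangles the claim is exactly the product formula in
      \<open>has_indep_increments\<close>.\<close>
    have joint: "distr N (\<Pi>\<^sub>M j\<in>I. borel) (\<lambda>\<omega>. \<lambda>j\<in>I. Z j \<omega>) \<Otimes>\<^sub>M D (b - s)
        = distr N ((\<Pi>\<^sub>M j\<in>I. borel) \<Otimes>\<^sub>M borel) (\<lambda>\<omega>. (\<lambda>j\<in>I. Z j \<omega>, Z b \<omega> - Z s \<omega>))"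
    proof (rule pair_measure_eqI)
      show "sigma_finite_measure (distr N (\<Pi>\<^sub>M j\<in>I. borel) (\<lambda>\<omega>. \<lambda>j\<in>I. Z j \<omega>))"
        "sigma_finite_measure (D (b - s))" by unfold_locales
      show "sets (distr N (\<Pi>\<^sub>M j\<in>I. borel) (\<lambda>\<omega>. \<lambda>j\<in>I. Z j \<omega>) \<Otimes>\<^sub>M D (b - s))
          = sets (distr N ((\<Pi>\<^sub>M j\<in>I. borel) \<Otimes>\<^sub>M borel) (\<lambda>\<omega>. (\<lambda>j\<in>I. Z j \<omega>, Z b \<omega> - Z s \<omega>)))"
        using D(2) by (simp cong: sets_pair_measure_cong)
      fix A C
      assume "A \<in> sets (distr N (\<Pi>\<^sub>M j\<in>I. borel) (\<lambda>\<omega>. \<lambda>j\<in>I. Z j \<omega>))" "C \<in> sets (D (b - s))"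
      then have AC: "A \<in> sets (\<Pi>\<^sub>M j\<in>I. borel)" "C \<in> sets borel" using D(2) by simp_all
      have "emeasure (distr N ((\<Pi>\<^sub>M j\<in>I. borel) \<Otimes>\<^sub>M borel) (\<lambda>\<omega>. (\<lambda>j\<in>I. Z j \<omega>, Z b \<omega> - Z s \<omega>))) (A \<times> C)
          = emeasure N {\<omega> \<in> space N. (\<lambda>j\<in>I. Z j \<omega>) \<in> A \<and> Z b \<omega> - Z s \<omega> \<in> C}"
        using AC by (subst emeasure_distr) (auto intro!: arg_cong[where f = "emeasure N"])
      also have "\<dots> = emeasure N {\<omega> \<in> space N. (\<lambda>j\<in>I. Z j \<omega>) \<in> A} * emeasure (D (b - s)) C"
        by (rule has_indep_incrementsD[OF Z I(1,3,4,5) AC])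
      also have "emeasure N {\<omega> \<in> space N. (\<lambda>j\<in>I. Z j \<omega>) \<in> A}
          = emeasure (distr N (\<Pi>\<^sub>M j\<in>I. borel) (\<lambda>\<omega>. \<lambda>j\<in>I. Z j \<omega>)) A"
        using AC by (subst emeasure_distr) (auto intro!: arg_cong[where f = "emeasure N"])
      finally show "emeasure (distr N (\<Pi>\<^sub>M j\<in>I. borel) (\<lambda>\<omega>. \<lambda>j\<in>I. Z j \<omega>)) A * emeasure (D (b - s)) C
        = emeasure (distr N ((\<Pi>\<^sub>M j\<in>I. borel) \<Otimes>\<^sub>M borel) (\<lambda>\<omega>. (\<lambda>j\<in>I. Z j \<omega>, Z b \<omega> - Z s \<omega>))) (A \<times> C)"
        by (rule sym)
    qed
    show ?thesis
      unfolding joint using I(2,6)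
      by (subst distr_distr) (auto simp: comp_def g_def[unfolded fun_eq_iff, rule_format] fun_eq_iff intro!: distr_cong)
  qed
  have IH: "distr M (\<Pi>\<^sub>M j\<in>I. borel) (\<lambda>\<omega>. \<lambda>j\<in>I. Y j \<omega>)
      = distr M' (\<Pi>\<^sub>M j\<in>I. borel) (\<lambda>\<omega>. \<lambda>j\<in>I. Y' j \<omega>)"
    unfolding I_def by (rule insert.IH) (use insert.prems in auto)
  have "insert 0 (insert b J) = insert b I" by (auto simp: I_def)
  then show ?case
    using *[OF \<open>prob_space M\<close> Y] *[OF \<open>prob_space M'\<close> Y'] IH by (simp only:)
qed

text \<open>Cylinder sets determine a finite measure on path space, which reduces the claim to the
  finite-dimensional laws.\<close>

lemma path_law_unique:
  fixes Y :: "real \<Rightarrow> 'a \<Rightarrow> 'v::euclidean_space" and Y' :: "real \<Rightarrow> 'b \<Rightarrow> 'v"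
  assumes M: "prob_space M" "prob_space M'"
    and D: "\<And>d. 0 < d \<Longrightarrow> prob_space (D d)" "\<And>d. sets (D d) = sets borel"
    and Y: "has_indep_increments M D Y" and Y': "has_indep_increments M' D Y'"
    and start: "distr M borel (Y 0) = distr M' borel (Y' 0)"
  shows "path_law M Y = path_law M' Y'"
proof (rule measure_eqI_PiM_infinite)
  show "sets (path_law M Y) = sets path_algebra" "sets (path_law M' Y') = sets path_algebra"
    by (simp_all add: path_law_def)
  have meas: "(\<lambda>\<omega>. \<lambda>s\<in>{0..}. Z s \<omega>) \<in> N \<rightarrow>\<^sub>M path_algebra" if "has_indep_increments N D Z"
    for N :: "'c measure" and Z :: "real \<Rightarrow> 'c \<Rightarrow> 'v"
    using that by (intro measurable_restrict) (simp add: has_indep_increments_def)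
  interpret M: prob_space M by fact
  interpret L: prob_space "path_law M Y"
    unfolding path_law_def by (intro M.prob_space_distr meas Y)
  show "finite_measure (path_law M Y)" by unfold_locales
  fix A :: "real \<Rightarrow> 'v set" and J :: "real set"
  assume J: "finite J" "J \<subseteq> {0..}" and A: "\<And>i. i \<in> J \<Longrightarrow> A i \<in> sets borel"
  \<comment> \<open>Time 0 is adjoined because the finite-dimensional laws are compared on index
    sets containing 0; the event \<open>?R\<close> still constrains only the times in
    \<open>J\<close>.\<close>
  define I where "I = insert 0 (J - {0})"
  have I: "finite I" "J \<subseteq> I" "I \<subseteq> {0..}" using J by (auto simp: I_def)
  let ?R = "{v \<in> space (\<Pi>\<^sub>M j\<in>I. borel). \<forall>j\<in>J. v j \<in> A j}"
  have R: "?R \<in> sets (\<Pi>\<^sub>M j\<in>I. borel)"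
  proof (rule sets.sets_Collect_finite_All[OF _ J(1)])
    fix j assume "j \<in> J"
    with I A have [measurable]: "(\<lambda>v. v j) \<in> (\<Pi>\<^sub>M j\<in>I. borel) \<rightarrow>\<^sub>M borel" "A j \<in> sets borel"
      by (auto intro: measurable_component_singleton)
    show "{v \<in> space (\<Pi>\<^sub>M j\<in>I. borel). v j \<in> A j} \<in> sets (\<Pi>\<^sub>M j\<in>I. borel)"
      by measurable
  qed
  have *: "emeasure (path_law N Z) (prod_emb {0..} (\<lambda>_. borel) J (Pi\<^sub>E J A))
      = emeasure (distr N (\<Pi>\<^sub>M j\<in>I. borel) (\<lambda>\<omega>. \<lambda>j\<in>I. Z j \<omega>)) ?R"
    if Z: "has_indep_increments N D Z" for N :: "'c measure" and Z :: "real \<Rightarrow> 'c \<Rightarrow> 'v"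
  proof -
    have "(\<lambda>\<omega>. \<lambda>j\<in>I. Z j \<omega>) \<in> N \<rightarrow>\<^sub>M (\<Pi>\<^sub>M j\<in>I. borel)"
      using I Z by (intro measurable_restrict) (auto simp: has_indep_increments_def subset_eq)
    then have "emeasure (distr N (\<Pi>\<^sub>M j\<in>I. borel) (\<lambda>\<omega>. \<lambda>j\<in>I. Z j \<omega>)) ?R
        = emeasure N {\<omega> \<in> space N. \<forall>j\<in>J. Z j \<omega> \<in> A j}"
      using R I by (subst emeasure_distr) (auto intro!: arg_cong[where f = "emeasure N"] simp: space_PiM)
    moreover have "emeasure (path_law N Z) (prod_emb {0..} (\<lambda>_. borel) J (Pi\<^sub>E J A))
        = emeasure N {\<omega> \<in> space N. \<forall>j\<in>J. Z j \<omega> \<in> A j}"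
    proof -
      have "prod_emb {0..} (\<lambda>_. borel) J (Pi\<^sub>E J A) \<in> sets (\<Pi>\<^sub>M s\<in>{0..}. borel)"
        using J A by (intro sets_PiM_I) auto
      moreover have "(\<lambda>\<omega>. \<lambda>s\<in>{0..}. Z s \<omega>) -` prod_emb {0..} (\<lambda>_. borel) J (Pi\<^sub>E J A) \<inter> space N
          = {\<omega> \<in> space N. \<forall>j\<in>J. Z j \<omega> \<in> A j}"
        using J by (auto simp: prod_emb_def restrict_PiE_iff Int_absorb1)
      ultimately show ?thesis
        unfolding path_law_def by (simp add: emeasure_distr[OF meas[OF Z]])
    qed
    ultimately show ?thesis by simp
  qed
  show "emeasure (path_law M Y) (prod_emb {0..} (\<lambda>_. borel) J (Pi\<^sub>E J A))
      = emeasure (path_law M' Y') (prod_emb {0..} (\<lambda>_. borel) J (Pi\<^sub>E J A))"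
  proof -
    have "finite (J - {0})" "J - {0} \<subseteq> {0<..}" using J by force+
    from finite_dim_law_unique[OF M D Y Y' start this] show ?thesis
      unfolding *[OF Y] *[OF Y'] I_def by (simp only:)
  qed
qed

text \<open>The limit \<open>X\<close> is a variable on \<open>M\<close>, not on path space, so
  convergence to it cannot be transferred as such. Its Cauchy form mentions only the functionals
  \<open>\<Phi> k\<close> and is an event of path space. Completeness gives a limit on
  \<open>N\<close>, and the limit functional has the same law under both equal path laws.\<close>

lemma path_law_transfer:
  fixes \<Phi> :: "nat \<Rightarrow> (real \<Rightarrow> 'v::euclidean_space) \<Rightarrow> 'v"
  assumes Y: "\<forall>s\<ge>0. Y s \<in> borel_measurable M"
    and Z: "\<forall>s\<ge>0. Z s \<in> borel_measurable N"
    and law: "path_law M Y = path_law N Z"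
    and \<Phi>[measurable]: "\<And>k. \<Phi> k \<in> path_algebra \<rightarrow>\<^sub>M borel"
    and X[measurable]: "X \<in> borel_measurable M"
    and lim: "AE \<omega> in M. (\<lambda>k. \<Phi> k (\<lambda>s\<in>{0..}. Y s \<omega>)) \<longlonglongrightarrow> X \<omega>"
  shows "AE z in N. convergent (\<lambda>k. \<Phi> k (\<lambda>s\<in>{0..}. Z s z))"
    and "distr M borel X = distr N borel (\<lambda>z. lim (\<lambda>k. \<Phi> k (\<lambda>s\<in>{0..}. Z s z)))"
proof -
  have [measurable]: "(\<lambda>\<omega>. \<lambda>s\<in>{0..}. Y s \<omega>) \<in> M \<rightarrow>\<^sub>M path_algebra"
    "(\<lambda>z. \<lambda>s\<in>{0..}. Z s z) \<in> N \<rightarrow>\<^sub>M path_algebra"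
    using Y Z by (auto intro!: measurable_restrict)
  have "AE v in path_law M Y. Cauchy (\<lambda>k. \<Phi> k v)"
    unfolding path_law_def
    by (subst AE_distr_iff) (use lim in \<open>auto elim!: eventually_mono intro: LIMSEQ_imp_Cauchy\<close>)
  then have "AE v in path_law N Z. Cauchy (\<lambda>k. \<Phi> k v)"
    by (simp only: law)
  then show "AE z in N. convergent (\<lambda>k. \<Phi> k (\<lambda>s\<in>{0..}. Z s z))"
    unfolding path_law_def by (subst (asm) AE_distr_iff) (auto simp flip: Cauchy_convergent_iff)
  \<comment> \<open>\<open>lim\<close> is total; its arbitrary value on divergent sequences matters
    only on a null set.\<close>
  let ?F = "\<lambda>v. lim (\<lambda>k. \<Phi> k v)"
  have "distr M borel X = distr M borel (\<lambda>\<omega>. ?F (\<lambda>s\<in>{0..}. Y s \<omega>))"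
    by (rule distr_cong_AE) (use lim in \<open>auto elim!: eventually_mono dest: limI\<close>)
  also have "\<dots> = distr (path_law M Y) borel ?F"
    unfolding path_law_def by (subst distr_distr) (auto simp: comp_def)
  also have "\<dots> = distr N borel (\<lambda>z. ?F (\<lambda>s\<in>{0..}. Z s z))"
    unfolding law unfolding path_law_def by (subst distr_distr) (auto simp: comp_def)
  finally show "distr M borel X = distr N borel (\<lambda>z. ?F (\<lambda>s\<in>{0..}. Z s z))" .
qed

section \<open>Gaussian increments of the driving noise\<close>

lemma measurable_vec_lambda:
  "(\<lambda>f. \<chi> i. f i) \<in> (\<Pi>\<^sub>M i\<in>(UNIV :: 'n::finite set). borel) \<rightarrow>\<^sub>M (borel :: (real ^ 'n) measure)"
proof (rule borel_measurable_euclidean_space[THEN iffD2], rule)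
  fix b :: "real ^ 'n" assume "b \<in> Basis"
  then obtain i and r :: real where "r \<in> Basis" "b = axis i r"
    unfolding Basis_vec_def by blast
  then have b: "b = axis i 1" by simp
  have "(\<lambda>f :: 'n \<Rightarrow> real. f i) \<in> borel_measurable (\<Pi>\<^sub>M i\<in>UNIV. borel)"
    by (rule measurable_component_singleton) simp
  then show "(\<lambda>f. (\<chi> i. f i) \<bullet> b) \<in> borel_measurable (\<Pi>\<^sub>M i\<in>UNIV. borel)"
    by (simp add: b inner_axis)
qed

text \<open>An image measure and not a density, so that \<sigma> = 0 is covered: for d > 0 it is
  then the point mass at the origin.\<close>

definition gaussian_law :: "real \<Rightarrow> real \<Rightarrow> (real ^ 'n::finite) measure" where
  "gaussian_law \<sigma> d = distr (\<Pi>\<^sub>M i\<in>UNIV. density lborel (normal_density 0 (sqrt d))) borel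
     (\<lambda>f. sqrt (2 * \<sigma>) *\<^sub>R (\<chi> i. f i))"

lemma gaussian_map_measurable:
  "(\<lambda>f. r *\<^sub>R (\<chi> i. f i)) \<in> (\<Pi>\<^sub>M i\<in>(UNIV :: 'n::finite set). density lborel (normal_density 0 s))
    \<rightarrow>\<^sub>M (borel :: (real ^ 'n) measure)"
proof -
  have "sets (\<Pi>\<^sub>M i\<in>(UNIV :: 'n set). density lborel (normal_density 0 s)) = sets (\<Pi>\<^sub>M i\<in>(UNIV :: 'n set). borel)"
    by (intro sets_PiM_cong) auto
  then show ?thesis
    using measurable_vec_lambda[where 'n='n]
    by (intro borel_measurable_scaleR) (auto cong: measurable_cong_sets)
qed

lemma sets_gaussian_law: "sets (gaussian_law \<sigma> d) = sets borel"
  by (simp add: gaussian_law_def)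

lemma prob_space_gaussian_law:
  assumes "0 < d"
  shows "prob_space (gaussian_law \<sigma> d :: (real ^ 'n::finite) measure)"
proof -
  interpret prob_space "\<Pi>\<^sub>M i\<in>(UNIV :: 'n set). density lborel (normal_density 0 (sqrt d))"
    using assms by (intro prob_space_PiM prob_space_normal_density) simp
  show ?thesis
    unfolding gaussian_law_def by (rule prob_space_distr[OF gaussian_map_measurable])
qed

lemma brownian_measurable:
  assumes "filtered_prob_space M F" "brownian_motion M F B" "0 \<le> r" "r \<le> s"
  shows "B r \<in> borel_measurable (F s)" "B r \<in> borel_measurable M"
proof -
  have sub: "sets (F r) \<subseteq> sets (F s)" "sets (F r) \<subseteq> sets M" "space (F r) = space M" "space (F s) = space M"
    using assms(1,4) filtration.sets_F_mono[of "space M" F r s]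
    by (auto simp: filtered_prob_space_def subalgebra_def)
  moreover have "B r \<in> borel_measurable (F r)"
    using assms(2,3) by (simp add: brownian_motion_def adapted_def)
  ultimately show "B r \<in> borel_measurable (F s)" "B r \<in> borel_measurable M"
    unfolding measurable_def by auto
qed

text \<open>Independence makes the joint law of the coordinate increments a product of normal laws,
  and \<open>gaussian_law\<close> is its image under scaling.\<close>

lemma brownian_increment_law:
  fixes B :: "real \<Rightarrow> 'a \<Rightarrow> real ^ 'n::finite"
  assumes F: "filtered_prob_space M F" and B: "brownian_motion M F B" and st: "0 \<le> s" "s < t"
  shows "distr M borel (\<lambda>\<omega>. sqrt (2 * \<sigma>) *\<^sub>R (B t \<omega> - B s \<omega>)) = gaussian_law \<sigma> (t - s)"
proof -
  interpret prob_space M using F by (simp add: filtered_prob_space_def)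
  let ?D = "\<lambda>i \<omega>. B t \<omega> $ i - B s \<omega> $ i"
  let ?N = "density lborel (\<lambda>x. ennreal (normal_density 0 (sqrt (t - s)) x))"
  have ind: "indep_vars (\<lambda>_. borel) ?D UNIV"
    and dist: "\<And>i. distributed M lborel (?D i) (normal_density 0 (sqrt (t - s)))"
    using B st unfolding brownian_motion_def by blast+
  have meas: "?D i \<in> borel_measurable M" for i
    using dist[of i] by (simp add: distributed_def)
  have "distr M borel (?D i) = ?N" for i
  proof -
    have "distr M borel (?D i) = distr M lborel (?D i)" by (intro distr_cong) auto
    with dist[of i] show ?thesis by (simp add: distributed_def)
  qed
  then have joint: "distr M (\<Pi>\<^sub>M i\<in>UNIV. borel) (\<lambda>\<omega>. \<lambda>i\<in>UNIV. ?D i \<omega>) = (\<Pi>\<^sub>M i\<in>UNIV. ?N)"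
    using indep_vars_iff_distr_eq_PiM[where I=UNIV and X="?D" and M'="\<lambda>_. borel"] ind meas by simp
  have "(\<lambda>\<omega>. \<lambda>i\<in>UNIV. ?D i \<omega>) \<in> M \<rightarrow>\<^sub>M (\<Pi>\<^sub>M i\<in>UNIV. borel)"
    by (rule measurable_restrict) (rule meas)
  moreover have "(\<lambda>f. sqrt (2 * \<sigma>) *\<^sub>R (\<chi> i. f i)) \<in> (\<Pi>\<^sub>M i\<in>UNIV. borel) \<rightarrow>\<^sub>M (borel :: (real ^ 'n) measure)"
    by (intro borel_measurable_scaleR measurable_vec_lambda) simp
  ultimately have "gaussian_law \<sigma> (t - s) = distr M borel ((\<lambda>f. sqrt (2 * \<sigma>) *\<^sub>R (\<chi> i. f i)) \<circ> (\<lambda>\<omega>. \<lambda>i\<in>UNIV. ?D i \<omega>))"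
    unfolding gaussian_law_def joint[symmetric] by (intro distr_distr)
  also have "\<dots> = distr M borel (\<lambda>\<omega>. sqrt (2 * \<sigma>) *\<^sub>R (B t \<omega> - B s \<omega>))"
    by (rule arg_cong[where f = "distr M borel"]) (simp add: fun_eq_iff vec_eq_iff)
  finally show ?thesis by simp
qed

text \<open>Values up to time \<open>s\<close> are measurable for \<open>F s\<close>, of which the
  next Brownian increment is independent; the starting value enters through \<open>F 0\<close>.
  Subtracting \<open>B 0\<close> makes the process start at \<open>Z\<close> at every sample point,
  not just almost surely.\<close>

lemma brownian_indep_increments:
  fixes B :: "real \<Rightarrow> 'a \<Rightarrow> real ^ 'n::finite"
  assumes F: "filtered_prob_space M F" and B: "brownian_motion M F B"
    and Z: "Z \<in> borel_measurable (F 0)"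
  shows "has_indep_increments M (gaussian_law \<sigma>) (\<lambda>s \<omega>. Z \<omega> + sqrt (2 * \<sigma>) *\<^sub>R (B s \<omega> - B 0 \<omega>))"
    (is "has_indep_increments M _ ?Y")
proof -
  interpret prob_space M using F by (simp add: filtered_prob_space_def)
  have sub: "subalgebra M (F s)" "space (F s) = space M" for s
    using F by (auto simp: filtered_prob_space_def subalgebra_def)
  have ZF: "Z \<in> borel_measurable (F s)" if "0 \<le> s" for s
    using Z sub(2) filtration.sets_F_mono[of "space M" F 0 s] F that
    unfolding measurable_def filtered_prob_space_def by auto
  have YF: "?Y r \<in> borel_measurable (F s)" if "0 \<le> r" "r \<le> s" for r s
    using ZF[of s] brownian_measurable(1)[OF F B that] brownian_measurable(1)[OF F B order_refl, of s] that
    by (intro borel_measurable_add borel_measurable_scaleR borel_measurable_diff) auto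
  have YM: "?Y r \<in> borel_measurable M" if "0 \<le> r" for r
    by (rule measurable_from_subalg[OF sub(1) YF[OF that order_refl]])
  show ?thesis
    unfolding has_indep_increments_def
  proof (intro conjI allI impI)
    fix J :: "real set" and s t :: real and A :: "(real \<Rightarrow> real ^ 'n) set" and C :: "(real ^ 'n) set"
    assume *: "finite J \<and> J \<subseteq> {0..s} \<and> 0 \<le> s \<and> s < t \<and> A \<in> sets (\<Pi>\<^sub>M j\<in>J. borel) \<and> C \<in> sets borel"
    let ?E1 = "{\<omega> \<in> space M. (\<lambda>j\<in>J. ?Y j \<omega>) \<in> A}"
    let ?E2 = "{\<omega> \<in> space M. sqrt (2 * \<sigma>) *\<^sub>R (B t \<omega> - B s \<omega>) \<in> C}"
    have E1: "?E1 \<in> sets (F s)"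
    proof -
      have "(\<lambda>\<omega>. \<lambda>j\<in>J. ?Y j \<omega>) \<in> F s \<rightarrow>\<^sub>M (\<Pi>\<^sub>M j\<in>J. borel)"
        using * by (intro measurable_restrict YF) auto
      from measurable_sets[OF this, of A] * show ?thesis
        by (simp add: sub(2) vimage_def Int_def conj_commute)
    qed
    have E2: "?E2 \<in> sets (vimage_algebra (space M) (\<lambda>\<omega>. B t \<omega> - B s \<omega>) borel)"
    proof -
      have "(\<lambda>v :: real ^ 'n. sqrt (2 * \<sigma>) *\<^sub>R v) \<in> borel_measurable borel" by simp
      from measurable_sets[OF this, of C] * have "{v. sqrt (2 * \<sigma>) *\<^sub>R v \<in> C} \<in> sets (borel :: (real ^ 'n) measure)"
        by (simp add: vimage_def)
      from in_vimage_algebra[OF this, of "\<lambda>\<omega>. B t \<omega> - B s \<omega>" "space M"] show ?thesis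
        by (simp add: vimage_def Int_def conj_commute)
    qed
    have ind: "indep_set (sets (F s)) (sets (vimage_algebra (space M) (\<lambda>\<omega>. B t \<omega> - B s \<omega>) borel))"
      using B * unfolding brownian_motion_def by blast
    have "emeasure M ?E2 = emeasure (distr M borel (\<lambda>\<omega>. sqrt (2 * \<sigma>) *\<^sub>R (B t \<omega> - B s \<omega>))) C"
    proof -
      have [measurable]: "B t \<in> borel_measurable M" "B s \<in> borel_measurable M"
        using brownian_measurable(2)[OF F B _ order_refl] * by auto
      show ?thesis
        using * by (subst emeasure_distr) (auto intro!: arg_cong[where f = "emeasure M"])
    qed
    also have "\<dots> = emeasure (gaussian_law \<sigma> (t - s)) C"
      using brownian_increment_law[OF F B] * by simp
    finally have law: "emeasure M ?E2 = emeasure (gaussian_law \<sigma> (t - s)) C" .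
    have "{\<omega> \<in> space M. (\<lambda>j\<in>J. ?Y j \<omega>) \<in> A \<and> ?Y t \<omega> - ?Y s \<omega> \<in> C} = ?E1 \<inter> ?E2"
      by (auto simp: scaleR_diff_right)
    then have "emeasure M {\<omega> \<in> space M. (\<lambda>j\<in>J. ?Y j \<omega>) \<in> A \<and> ?Y t \<omega> - ?Y s \<omega> \<in> C}
        = ennreal (prob (?E1 \<inter> ?E2))"
      by (simp only: emeasure_eq_measure)
    also have "\<dots> = emeasure M ?E1 * emeasure M ?E2"
      by (simp only: indep_setD[OF ind E1 E2] emeasure_eq_measure ennreal_mult measure_nonneg)
    finally show "emeasure M {\<omega> \<in> space M. (\<lambda>j\<in>J. ?Y j \<omega>) \<in> A \<and> ?Y t \<omega> - ?Y s \<omega> \<in> C}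
        = emeasure M ?E1 * emeasure (gaussian_law \<sigma> (t - s)) C"
      unfolding law .
  qed (rule YM)
qed

text \<open>Fubini: for a fixed first component the path is \<open>W\<close> shifted by a constant,
  which preserves increments and merely translates the event about the past. The factor for the
  increment is thus the same in every slice and leaves the integral.\<close>

lemma pair_indep_increments:
  fixes W :: "real \<Rightarrow> 'a \<Rightarrow> 'v::euclidean_space"
  assumes M: "prob_space M" and W: "has_indep_increments M D W" and u: "u \<in> borel_measurable P"
  shows "has_indep_increments (P \<Otimes>\<^sub>M M) D (\<lambda>s z. u (fst z) + W s (snd z))"
proof -
  interpret M: prob_space M by fact
  note u[measurable]
  have W_meas[measurable]: "\<And>s. 0 \<le> s \<Longrightarrow> W s \<in> borel_measurable M"
    using W by (simp add: has_indep_increments_def)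
  show ?thesis
    unfolding has_indep_increments_def
  proof (intro conjI allI impI)
    show "(\<lambda>z. u (fst z) + W s (snd z)) \<in> borel_measurable (P \<Otimes>\<^sub>M M)" if "0 \<le> s" for s
      using that by measurable
    fix J :: "real set" and s t :: real and A :: "(real \<Rightarrow> 'v) set" and C :: "'v set"
    assume *: "finite J \<and> J \<subseteq> {0..s} \<and> 0 \<le> s \<and> s < t \<and> A \<in> sets (\<Pi>\<^sub>M j\<in>J. borel) \<and> C \<in> sets borel"
    then have J: "finite J" "J \<subseteq> {0..s}" and st: "0 \<le> s" "s < t"
      and A[measurable]: "A \<in> sets (\<Pi>\<^sub>M j\<in>J. borel)" and C[measurable]: "C \<in> sets borel" by auto
    have J0: "0 \<le> j" if "j \<in> J" for j using that J by auto
    let ?Y = "\<lambda>s z. u (fst z) + W s (snd z)"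
    let ?E = "{z \<in> space (P \<Otimes>\<^sub>M M). (\<lambda>j\<in>J. ?Y j z) \<in> A}"
    let ?G = "{z \<in> space (P \<Otimes>\<^sub>M M). (\<lambda>j\<in>J. ?Y j z) \<in> A \<and> ?Y t z - ?Y s z \<in> C}"
    have YJ[measurable]: "(\<lambda>z. \<lambda>j\<in>J. ?Y j z) \<in> P \<Otimes>\<^sub>M M \<rightarrow>\<^sub>M (\<Pi>\<^sub>M j\<in>J. borel)"
      using J0 by (intro measurable_restrict) measurable
    have Yts[measurable]: "?Y t \<in> borel_measurable (P \<Otimes>\<^sub>M M)" "?Y s \<in> borel_measurable (P \<Otimes>\<^sub>M M)"
    proof -
      have "0 \<le> t" using st by simp
      then show "?Y t \<in> borel_measurable (P \<Otimes>\<^sub>M M)" by measurable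
      show "?Y s \<in> borel_measurable (P \<Otimes>\<^sub>M M)" using st(1) by measurable
    qed
    have E: "?E \<in> sets (P \<Otimes>\<^sub>M M)" by measurable
    have "{z \<in> space (P \<Otimes>\<^sub>M M). ?Y t z - ?Y s z \<in> C} \<in> sets (P \<Otimes>\<^sub>M M)" by measurable
    from sets.Int[OF E this] have G: "?G \<in> sets (P \<Otimes>\<^sub>M M)"
      by (simp add: Int_def conj_ac cong: conj_cong)
    have slice: "emeasure M (Pair p -` ?G) = emeasure M (Pair p -` ?E) * emeasure (D (t - s)) C"
      if p: "p \<in> space P" for p
    proof -
      \<comment> \<open>The past event for the shifted path, pulled back to an event for
        \<open>W\<close>.\<close>
      let ?A = "{v \<in> space (\<Pi>\<^sub>M j\<in>J. borel). (\<lambda>j\<in>J. u p + v j) \<in> A}"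
      have "(\<lambda>v. \<lambda>j\<in>J. u p + v j) \<in> (\<Pi>\<^sub>M j\<in>J. borel) \<rightarrow>\<^sub>M (\<Pi>\<^sub>M j\<in>J. borel)"
        by (intro measurable_restrict borel_measurable_add measurable_component_singleton) auto
      from measurable_sets[OF this A] have A': "?A \<in> sets (\<Pi>\<^sub>M j\<in>J. borel)"
        by (simp add: vimage_def Int_def conj_commute)
      have in_A: "(\<lambda>j\<in>J. W j \<omega>) \<in> ?A \<longleftrightarrow> (\<lambda>j\<in>J. u p + W j \<omega>) \<in> A" for \<omega>
      proof -
        have "(\<lambda>j\<in>J. W j \<omega>) \<in> space (\<Pi>\<^sub>M j\<in>J. borel)" by (simp add: space_PiM)
        moreover have "(\<lambda>j\<in>J. u p + (\<lambda>j\<in>J. W j \<omega>) j) = (\<lambda>j\<in>J. u p + W j \<omega>)"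
          by (rule restrict_ext) simp
        ultimately show ?thesis by (simp only: mem_Collect_eq simp_thms)
      qed
      have "Pair p -` ?G = {\<omega> \<in> space M. (\<lambda>j\<in>J. W j \<omega>) \<in> ?A \<and> W t \<omega> - W s \<omega> \<in> C}"
        unfolding in_A using p by (auto simp: space_pair_measure)
      moreover have "Pair p -` ?E = {\<omega> \<in> space M. (\<lambda>j\<in>J. W j \<omega>) \<in> ?A}"
        unfolding in_A using p by (auto simp: space_pair_measure)
      ultimately show ?thesis
        using has_indep_incrementsD[OF W J st A' C] by (simp only:)
    qed
    have "emeasure (P \<Otimes>\<^sub>M M) ?G = (\<integral>\<^sup>+p. emeasure M (Pair p -` ?G) \<partial>P)"
      by (rule M.emeasure_pair_measure_alt[OF G])
    also have "\<dots> = (\<integral>\<^sup>+p. emeasure M (Pair p -` ?E) * emeasure (D (t - s)) C \<partial>P)"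
      by (rule nn_integral_cong) (rule slice)
    also have "\<dots> = (\<integral>\<^sup>+p. emeasure M (Pair p -` ?E) \<partial>P) * emeasure (D (t - s)) C"
      by (rule nn_integral_multc) (rule M.measurable_emeasure_Pair[OF E])
    also have "(\<integral>\<^sup>+p. emeasure M (Pair p -` ?E) \<partial>P) = emeasure (P \<Otimes>\<^sub>M M) ?E"
      by (rule M.emeasure_pair_measure_alt[OF E, symmetric])
    finally show "emeasure (P \<Otimes>\<^sub>M M) ?G = emeasure (P \<Otimes>\<^sub>M M) ?E * emeasure (D (t - s)) C" .
  qed
qed

section \<open>Contraction in Wasserstein distance\<close>

lemma sqrt_ennreal_mono: "x \<le> y \<Longrightarrow> sqrt_ennreal x \<le> sqrt_ennreal y"
  by (auto simp: sqrt_ennreal_def top_unique less_top intro!: ennreal_leI enn2real_mono)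

lemma sqrt_ennreal_mult:
  assumes "0 < k"
  shows "sqrt_ennreal (ennreal (k\<^sup>2) * x) = ennreal k * sqrt_ennreal x"
proof (cases x rule: ennreal_cases)
  case (real r)
  then show ?thesis
    using assms by (simp add: sqrt_ennreal_def ennreal_mult[symmetric] real_sqrt_mult)
next
  case top
  then show ?thesis
    using assms by (simp add: sqrt_ennreal_def ennreal_mult_top)
qed

text \<open>Every coupling of the initial laws yields a competitor for the later ones, so no optimal
  coupling has to exist. The factor k^2 is first moved to the other side, so that the bound holds
  against each coupling and hence against the infimum.\<close>

lemma wasserstein2_contraction:
  assumes k: "0 < k"
    and step: "\<And>\<pi>. \<pi> \<in> couplings \<mu> \<nu> \<Longrightarrow> \<exists>\<pi>'\<in>couplings \<mu>' \<nu>'.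
      (\<integral>\<^sup>+p. ennreal ((dist (fst p) (snd p))\<^sup>2) \<partial>\<pi>')
        \<le> ennreal (k\<^sup>2) * (\<integral>\<^sup>+p. ennreal ((dist (fst p) (snd p))\<^sup>2) \<partial>\<pi>)"
  shows "wasserstein2 \<mu>' \<nu>' \<le> ennreal k * wasserstein2 \<mu> \<nu>"
proof -
  let ?c = "\<lambda>\<pi>. \<integral>\<^sup>+p. ennreal ((dist (fst p) (snd p))\<^sup>2) \<partial>\<pi>"
  let ?I = "INF \<pi>\<in>couplings \<mu> \<nu>. ?c \<pi>" and ?I' = "INF \<pi>\<in>couplings \<mu>' \<nu>'. ?c \<pi>"
  have inv: "ennreal (inverse (k\<^sup>2)) * ennreal (k\<^sup>2) = 1"
    using k by (simp add: ennreal_mult[symmetric])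
  have "ennreal (inverse (k\<^sup>2)) * ?I' \<le> ?I"
  proof (rule INF_greatest)
    fix \<pi> assume "\<pi> \<in> couplings \<mu> \<nu>"
    then obtain \<pi>' where "\<pi>' \<in> couplings \<mu>' \<nu>'" "?c \<pi>' \<le> ennreal (k\<^sup>2) * ?c \<pi>"
      using step by blast
    then have "?I' \<le> ennreal (k\<^sup>2) * ?c \<pi>"
      by (rule INF_lower2)
    then have "ennreal (inverse (k\<^sup>2)) * ?I' \<le> ennreal (inverse (k\<^sup>2)) * (ennreal (k\<^sup>2) * ?c \<pi>)"
      by (rule mult_left_mono) simp
    then show "ennreal (inverse (k\<^sup>2)) * ?I' \<le> ?c \<pi>"
      unfolding mult.assoc[symmetric] inv by simp
  qed
  then have "ennreal (k\<^sup>2) * (ennreal (inverse (k\<^sup>2)) * ?I') \<le> ennreal (k\<^sup>2) * ?I"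
    by (rule mult_left_mono) simp
  then have "?I' \<le> ennreal (k\<^sup>2) * ?I"
    unfolding mult.assoc[symmetric] using inv by (simp add: mult.commute)
  then show ?thesis
    unfolding wasserstein2_def sqrt_ennreal_mult[OF k, symmetric] by (rule sqrt_ennreal_mono)
qed

section \<open>Solutions and schemes as random variables\<close>

lemma euler_restrict:
  assumes "0 \<le> h"
  shows "euler b h (\<lambda>s\<in>{0..}. y s) k = euler b h y k"
  by (induction k) (use assms in auto)

lemma euler_measurable:
  fixes b :: "'v::euclidean_space \<Rightarrow> 'v"
  assumes b: "b \<in> borel_measurable borel" and h: "0 \<le> h"
  shows "(\<lambda>y. euler b h y k) \<in> path_algebra \<rightarrow>\<^sub>M borel"
proof (induction k)
  have comp: "(\<lambda>y :: real \<Rightarrow> 'v. y s) \<in> path_algebra \<rightarrow>\<^sub>M borel" if "0 \<le> s" for s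
    using that by (intro measurable_component_singleton) simp
  case 0
  show ?case using comp[of 0] by simp
  case (Suc k)
  have "(\<lambda>y :: real \<Rightarrow> 'v. y (real (Suc k) * h)) \<in> path_algebra \<rightarrow>\<^sub>M borel"
    "(\<lambda>y :: real \<Rightarrow> 'v. y (real k * h)) \<in> path_algebra \<rightarrow>\<^sub>M borel"
    using h by (auto intro!: comp)
  then show ?case
    unfolding euler.simps
    by (intro borel_measurable_add borel_measurable_diff borel_measurable_scaleR
        measurable_compose[OF Suc b] Suc) auto
qed

lemma particle_adapted_measurable:
  assumes "particle_solution \<alpha> \<sigma> U' M F B X" "0 \<le> t"
  shows "X t \<in> borel_measurable M"
  using assms unfolding particle_solution_def filtered_prob_space_def adapted_def
  by (auto intro: measurable_from_subalg)

text \<open>\<open>B 0\<close> vanishes only almost surely; off that null set the driver built from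
  B_s - B_0 agrees with the one in the integral equation.\<close>

lemma particle_path_solution:
  assumes "particle_solution \<alpha> \<sigma> U' M F B X"
  shows "AE \<omega> in M. path_solution \<alpha> U' (\<lambda>s. X 0 \<omega> + sqrt (2 * \<sigma>) *\<^sub>R (B s \<omega> - B 0 \<omega>)) (\<lambda>s. X s \<omega>)"
proof -
  have "AE \<omega> in M. B 0 \<omega> = 0" "AE \<omega> in M. continuous_on {0..} (\<lambda>t. X t \<omega>)"
    "AE \<omega> in M. AE t in lborel. 0 \<le> t \<longrightarrow> X t \<omega> \<in> ordered_configs"
    "AE \<omega> in M. \<forall>t\<ge>0. \<forall>i j. i \<noteq> j \<longrightarrow>
        set_integrable lborel {0..t} (\<lambda>s. V' \<alpha> (X s \<omega> $ i - X s \<omega> $ j))"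
    "AE \<omega> in M. \<forall>t\<ge>0. \<forall>i. X t \<omega> $ i = X 0 \<omega> $ i + sqrt (2 * \<sigma>) * B t \<omega> $ i
          + (LINT s:{0..t}|lborel. drift \<alpha> U' (X s \<omega>) i)"
    using assms unfolding particle_solution_def brownian_motion_def continuous_paths_def by auto
  then show ?thesis
  proof eventually_elim
    case (elim \<omega>)
    have eq: "(X 0 \<omega> + sqrt (2 * \<sigma>) *\<^sub>R (B t \<omega> - B 0 \<omega>)) $ i = X 0 \<omega> $ i + sqrt (2 * \<sigma>) * B t \<omega> $ i" for t i
      by (simp add: elim(1))
    show ?case
      unfolding path_solution_def eq by (intro conjI elim(2-5))
  qed
qed

lemma particle_indep_increments:
  assumes "particle_solution \<alpha> \<sigma> U' M F B X"
  shows "has_indep_increments M (gaussian_law \<sigma>) (\<lambda>s \<omega>. X 0 \<omega> + sqrt (2 * \<sigma>) *\<^sub>R (B s \<omega> - B 0 \<omega>))"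
  using assms unfolding particle_solution_def adapted_def
  by (intro brownian_indep_increments[where F = F]) auto

lemma driver_measurable:
  assumes "particle_solution \<alpha> \<sigma> U' M F B X" "0 \<le> s"
  shows "(\<lambda>\<omega>. X 0 \<omega> + sqrt (2 * \<sigma>) *\<^sub>R (B s \<omega> - B 0 \<omega>)) \<in> borel_measurable M"
  using particle_indep_increments[OF assms(1)] assms(2) by (simp add: has_indep_increments_def)

context one_sided_drift
begin

text \<open>The scheme reads a path only at nonnegative grid times, so it does not see the
  restriction to [0, \<infinity>) that turns paths into points of
  \<open>path_algebra\<close>.\<close>

lemma scheme_restrict:
  assumes "0 \<le> t"
  shows "scheme n m t (\<lambda>s\<in>{0..}. y s) = scheme n m t y"
  unfolding scheme_def using assms by (intro euler_restrict) simp

lemma scheme_measurable: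
  assumes "0 \<le> t"
  shows "scheme n m t \<in> path_algebra \<rightarrow>\<^sub>M borel"
  unfolding scheme_def using assms
  by (intro euler_measurable borel_measurable_continuous_onI trunc_drift_continuous) simp

lemma scheme_path_measurable:
  assumes "0 \<le> t" and Y: "\<And>s. 0 \<le> s \<Longrightarrow> Y s \<in> borel_measurable M"
  shows "(\<lambda>\<omega>. scheme n m t (\<lambda>s. Y s \<omega>)) \<in> borel_measurable M"
proof -
  have "(\<lambda>\<omega>. \<lambda>s\<in>{0..}. Y s \<omega>) \<in> M \<rightarrow>\<^sub>M path_algebra"
    using Y by (intro measurable_restrict) simp
  from measurable_compose[OF this scheme_measurable[OF assms(1)]] show ?thesis
    by (simp add: scheme_restrict[OF assms(1)])
qed

lemma scheme_converges_in_measure: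
  assumes sol: "particle_solution \<alpha> \<sigma> U' M F B X" and t: "0 \<le> t" and pos: "0 < \<epsilon>" "0 < \<eta>"
  shows "\<forall>\<^sub>F n in sequentially. \<forall>\<^sub>F m in sequentially.
    measure M {\<omega> \<in> space M. \<epsilon> \<le> norm (X t \<omega>
      - scheme n m t (\<lambda>s. X 0 \<omega> + sqrt (2 * \<sigma>) *\<^sub>R (B s \<omega> - B 0 \<omega>)))} < \<eta>"
proof -
  interpret prob_space M
    using sol by (simp add: particle_solution_def filtered_prob_space_def)
  show ?thesis
  proof (rule iterated_limit_in_measure[OF _ _ pos(2)])
    show "(\<lambda>\<omega>. norm (X t \<omega> - scheme n m t (\<lambda>s. X 0 \<omega> + sqrt (2 * \<sigma>) *\<^sub>R (B s \<omega> - B 0 \<omega>))))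
        \<in> borel_measurable M" for n m
      by (intro measurable_compose[OF _ borel_measurable_norm] borel_measurable_diff particle_adapted_measurable[OF sol t]
          scheme_path_measurable[OF t] driver_measurable[OF sol])
    show "AE \<omega> in M. \<forall>\<^sub>F n in sequentially. \<forall>\<^sub>F m in sequentially.
        norm (X t \<omega> - scheme n m t (\<lambda>s. X 0 \<omega> + sqrt (2 * \<sigma>) *\<^sub>R (B s \<omega> - B 0 \<omega>))) < \<epsilon>"
      using particle_path_solution[OF sol]
      by eventually_elim (rule scheme_converges[OF _ t pos(1)])
  qed
qed

lemma scheme_fast_AE:
  assumes sol: "particle_solution \<alpha> \<sigma> U' M F B X" and t: "0 \<le> t"
    and fast: "\<And>k. measure M {\<omega> \<in> space M. (1/2) ^ k \<le> norm (X t \<omega>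
      - scheme (N k) (L k) t (\<lambda>s. X 0 \<omega> + sqrt (2 * \<sigma>) *\<^sub>R (B s \<omega> - B 0 \<omega>)))} < (1/2) ^ k"
  shows "AE \<omega> in M. (\<lambda>k. scheme (N k) (L k) t
      (\<lambda>s\<in>{0..}. X 0 \<omega> + sqrt (2 * \<sigma>) *\<^sub>R (B s \<omega> - B 0 \<omega>))) \<longlonglongrightarrow> X t \<omega>"
proof -
  interpret prob_space M
    using sol by (simp add: particle_solution_def filtered_prob_space_def)
  have "AE \<omega> in M. (\<lambda>k. norm (X t \<omega>
      - scheme (N k) (L k) t (\<lambda>s. X 0 \<omega> + sqrt (2 * \<sigma>) *\<^sub>R (B s \<omega> - B 0 \<omega>)))) \<longlonglongrightarrow> 0"
  proof (rule AE_tendsto_0_of_fast_convergence)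
    show "(\<lambda>\<omega>. norm (X t \<omega> - scheme (N k) (L k) t
        (\<lambda>s. X 0 \<omega> + sqrt (2 * \<sigma>) *\<^sub>R (B s \<omega> - B 0 \<omega>)))) \<in> borel_measurable M" for k
      by (intro measurable_compose[OF _ borel_measurable_norm] borel_measurable_diff particle_adapted_measurable[OF sol t]
          scheme_path_measurable[OF t] driver_measurable[OF sol])
  qed (use fast in \<open>auto intro: less_imp_le\<close>)
  then show ?thesis
  proof eventually_elim
    case (elim \<omega>)
    then have "(\<lambda>k. scheme (N k) (L k) t (\<lambda>s. X 0 \<omega> + sqrt (2 * \<sigma>) *\<^sub>R (B s \<omega> - B 0 \<omega>))) \<longlonglongrightarrow> X t \<omega>"
      by (subst tendsto_dist_iff) (simp only: dist_norm norm_minus_commute)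
    then show ?case by (simp only: scheme_restrict[OF t])
  qed
qed

text \<open>Thresholds for convergence in measure are deterministic, so one pair (N k, L k) meets
  the conditions on both probability spaces and the stability bound. The tolerance (1/2)^k serves as
  distance, as probability (summable, for Borel-Cantelli) and as excess in the stability
  constant.\<close>

lemma common_subsequence:
  fixes X1 :: "real \<Rightarrow> 'b \<Rightarrow> real ^ 'n::{finite,linorder}"
    and X2 :: "real \<Rightarrow> 'c \<Rightarrow> real ^ 'n::{finite,linorder}"
  assumes sol1: "particle_solution \<alpha> \<sigma> U' M1 F1 B1 X1"
    and sol2: "particle_solution \<alpha> \<sigma> U' M2 F2 B2 X2" and t: "0 \<le> t"
  obtains N L where
    "AE \<omega> in M1. (\<lambda>k. scheme (N k) (L k) t
      (\<lambda>s\<in>{0..}. X1 0 \<omega> + sqrt (2 * \<sigma>) *\<^sub>R (B1 s \<omega> - B1 0 \<omega>))) \<longlonglongrightarrow> X1 t \<omega>"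
    "AE \<omega> in M2. (\<lambda>k. scheme (N k) (L k) t
      (\<lambda>s\<in>{0..}. X2 0 \<omega> + sqrt (2 * \<sigma>) *\<^sub>R (B2 s \<omega> - B2 0 \<omega>))) \<longlonglongrightarrow> X2 t \<omega>"
    "\<And>k (y :: real \<Rightarrow> real ^ 'n::{finite,linorder}) y'. \<forall>s\<ge>0. y s - y' s = y 0 - y' 0 \<Longrightarrow>
      norm (scheme (N k) (L k) t y - scheme (N k) (L k) t y') \<le> (exp (c * t) + (1/2) ^ k) * norm (y 0 - y' 0)"
proof -
  define P1 where "P1 k n m \<longleftrightarrow> measure M1 {\<omega> \<in> space M1. (1/2) ^ k \<le> norm (X1 t \<omega>
      - scheme n m t (\<lambda>s. X1 0 \<omega> + sqrt (2 * \<sigma>) *\<^sub>R (B1 s \<omega> - B1 0 \<omega>)))} < (1/2) ^ k" for k :: nat and n m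
  define P2 where "P2 k n m \<longleftrightarrow> measure M2 {\<omega> \<in> space M2. (1/2) ^ k \<le> norm (X2 t \<omega>
      - scheme n m t (\<lambda>s. X2 0 \<omega> + sqrt (2 * \<sigma>) *\<^sub>R (B2 s \<omega> - B2 0 \<omega>)))} < (1/2) ^ k" for k :: nat and n m
  define P3 where "P3 k n m \<longleftrightarrow> (\<forall>y y' :: real \<Rightarrow> (real, 'n) vec. (\<forall>s\<ge>0. y s - y' s = y 0 - y' 0) \<longrightarrow>
      norm (scheme n m t y - scheme n m t y') \<le> (exp (c * t) + (1/2) ^ k) * norm (y 0 - y' 0))" for k :: nat and n m
  have "\<exists>n m. P1 k n m \<and> P2 k n m \<and> P3 k n m" for k
  proof -
    have pos: "0 < (1/2 :: real) ^ k" by simp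
    have "\<forall>\<^sub>F n in sequentially. \<exists>m. P1 k n m \<and> P2 k n m \<and> P3 k n m"
      using scheme_converges_in_measure[OF sol1 t pos pos, folded P1_def]
        scheme_converges_in_measure[OF sol2 t pos pos, folded P2_def]
    proof eventually_elim
      case (elim n)
      then have "\<forall>\<^sub>F m in sequentially. P1 k n m \<and> P2 k n m \<and> P3 k n m"
        using scheme_stable[OF t pos, of n, where 'n = 'n, folded P3_def]
        by eventually_elim blast
      then show ?case by (rule eventually_happens'[OF sequentially_bot])
    qed
    then show ?thesis by (rule eventually_happens'[OF sequentially_bot])
  qed
  then obtain N L where P: "\<And>k. P1 k (N k) (L k) \<and> P2 k (N k) (L k) \<and> P3 k (N k) (L k)"
    by metis
  show ?thesis
  proof (rule that)
    show "AE \<omega> in M1. (\<lambda>k. scheme (N k) (L k) t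
      (\<lambda>s\<in>{0..}. X1 0 \<omega> + sqrt (2 * \<sigma>) *\<^sub>R (B1 s \<omega> - B1 0 \<omega>))) \<longlonglongrightarrow> X1 t \<omega>"
      using P unfolding P1_def by (intro scheme_fast_AE[OF sol1 t]) blast
    show "AE \<omega> in M2. (\<lambda>k. scheme (N k) (L k) t
      (\<lambda>s\<in>{0..}. X2 0 \<omega> + sqrt (2 * \<sigma>) *\<^sub>R (B2 s \<omega> - B2 0 \<omega>))) \<longlonglongrightarrow> X2 t \<omega>"
      using P unfolding P2_def by (intro scheme_fast_AE[OF sol2 t]) blast
    show "norm (scheme (N k) (L k) t y - scheme (N k) (L k) t y') \<le> (exp (c * t) + (1/2) ^ k) * norm (y 0 - y' 0)"
      if "\<forall>s\<ge>0. y s - y' s = y 0 - y' 0" for k and y y' :: "real \<Rightarrow> (real, 'n) vec"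
      using P that unfolding P3_def by blast
  qed
qed

text \<open>The second solution enters through the law of its driver, and the path that starts at
  the second component of \<pi> and uses the first noise has the same law. The limits
  \<open>S fst\<close> and \<open>S snd\<close> of the schemes therefore have the laws of the two
  solutions; whether they solve the equation on the product space is never asked.\<close>

lemma coupled_solutions:
  fixes X1 :: "real \<Rightarrow> 'b \<Rightarrow> real ^ 'n::{finite,linorder}"
    and X2 :: "real \<Rightarrow> 'c \<Rightarrow> real ^ 'n::{finite,linorder}"
  assumes sol1: "particle_solution \<alpha> \<sigma> U' M1 F1 B1 X1"
    and sol2: "particle_solution \<alpha> \<sigma> U' M2 F2 B2 X2" and t: "0 \<le> t"
    and \<pi>: "\<pi> \<in> couplings (distr M1 borel (X1 0)) (distr M2 borel (X2 0))"
  shows "\<exists>\<pi>'\<in>couplings (distr M1 borel (X1 t)) (distr M2 borel (X2 t)).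
    (\<integral>\<^sup>+p. ennreal ((dist (fst p) (snd p))\<^sup>2) \<partial>\<pi>')
      \<le> ennreal ((exp (c * t))\<^sup>2) * (\<integral>\<^sup>+p. ennreal ((dist (fst p) (snd p))\<^sup>2) \<partial>\<pi>)"
proof -
  let ?b = "borel :: (real, 'n) vec measure"
  interpret M1: prob_space M1
    using sol1 by (simp add: particle_solution_def filtered_prob_space_def)
  interpret M2: prob_space M2
    using sol2 by (simp add: particle_solution_def filtered_prob_space_def)
  have \<pi>_sets[measurable_cong]: "sets \<pi> = sets (?b \<Otimes>\<^sub>M ?b)"
    using \<pi> by (simp add: couplings_def cong: sets_pair_measure_cong)
  have \<pi>_fst: "distr \<pi> borel fst = distr M1 borel (X1 0)"
  proof -
    have "distr \<pi> borel fst = distr \<pi> (distr M1 borel (X1 0)) fst" by (rule distr_cong) auto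
    with \<pi> show ?thesis by (simp add: couplings_def)
  qed
  have \<pi>_snd: "distr \<pi> borel snd = distr M2 borel (X2 0)"
  proof -
    have "distr \<pi> borel snd = distr \<pi> (distr M2 borel (X2 0)) snd" by (rule distr_cong) auto
    with \<pi> show ?thesis by (simp add: couplings_def)
  qed
  have proj[measurable]: "fst \<in> \<pi> \<rightarrow>\<^sub>M ?b" "snd \<in> \<pi> \<rightarrow>\<^sub>M ?b"
    by measurable
  \<comment> \<open>\<open>couplings\<close> prescribes no total mass; mass 1 is inherited from the
    first marginal.\<close>
  have \<pi>_prob: "prob_space \<pi>"
  proof (rule prob_space_distrD[OF proj(1)])
    show "prob_space (distr \<pi> borel fst)"
      unfolding \<pi>_fst by (intro M1.prob_space_distr particle_adapted_measurable[OF sol1]) simp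
  qed
  \<comment> \<open>The product makes the coupled initial values independent of the noise; here
    \<open>M1\<close> supplies only the noise \<open>W\<close>, and the initial values come from
    \<pi>.\<close>
  define \<Omega> where "\<Omega> = \<pi> \<Otimes>\<^sub>M M1"
  interpret \<Omega>: prob_space \<Omega>
    unfolding \<Omega>_def by (rule prob_space_pair[OF \<pi>_prob M1.prob_space_axioms])
  define W where "W s \<omega> = sqrt (2 * \<sigma>) *\<^sub>R (B1 s \<omega> - B1 0 \<omega>)" for s \<omega>
  define Z where "Z u s z = u (fst z) + W s (snd z)"
    for u :: "(real, 'n) vec \<times> (real, 'n) vec \<Rightarrow> (real, 'n) vec" and s and z :: "((real, 'n) vec \<times> (real, 'n) vec) \<times> 'b"
  have W: "has_indep_increments M1 (gaussian_law \<sigma>) W"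
    using brownian_indep_increments[of M1 F1 B1 "\<lambda>_. 0" \<sigma>] sol1
    by (simp add: W_def[abs_def] particle_solution_def)
  have Z: "has_indep_increments \<Omega> (gaussian_law \<sigma>) (Z u)" if "u \<in> borel_measurable \<pi>" for u
    unfolding \<Omega>_def Z_def[abs_def] by (rule pair_indep_increments[OF M1.prob_space_axioms W that])
  have Z_meas: "Z u s \<in> borel_measurable \<Omega>" if "u \<in> borel_measurable \<pi>" "0 \<le> s" for u s
    using Z[OF that(1)] that(2) by (simp add: has_indep_increments_def)
  have Z_start: "distr \<Omega> borel (Z u 0) = distr \<pi> borel u" if u: "u \<in> borel_measurable \<pi>" for u
  proof -
    have "distr \<pi> borel u = distr (distr \<Omega> \<pi> fst) borel u"
      unfolding \<Omega>_def M1.distr_pair_fst ..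
    also have "\<dots> = distr \<Omega> borel (u \<circ> fst)"
      unfolding \<Omega>_def by (intro distr_distr u measurable_fst)
    also have "u \<circ> fst = Z u 0"
      by (simp add: fun_eq_iff Z_def W_def)
    finally show ?thesis by simp
  qed
  have law1: "path_law M1 (\<lambda>s \<omega>. X1 0 \<omega> + sqrt (2 * \<sigma>) *\<^sub>R (B1 s \<omega> - B1 0 \<omega>)) = path_law \<Omega> (Z fst)"
    using Z_start[OF proj(1)] \<pi>_fst
    by (intro path_law_unique[OF M1.prob_space_axioms \<Omega>.prob_space_axioms prob_space_gaussian_law
          sets_gaussian_law particle_indep_increments[OF sol1] Z[OF proj(1)]]) simp_all
  have law2: "path_law M2 (\<lambda>s \<omega>. X2 0 \<omega> + sqrt (2 * \<sigma>) *\<^sub>R (B2 s \<omega> - B2 0 \<omega>)) = path_law \<Omega> (Z snd)"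
    using Z_start[OF proj(2)] \<pi>_snd
    by (intro path_law_unique[OF M2.prob_space_axioms \<Omega>.prob_space_axioms prob_space_gaussian_law
          sets_gaussian_law particle_indep_increments[OF sol2] Z[OF proj(2)]]) simp_all
  obtain N L where
    conv1: "AE \<omega> in M1. (\<lambda>k. scheme (N k) (L k) t
      (\<lambda>s\<in>{0..}. X1 0 \<omega> + sqrt (2 * \<sigma>) *\<^sub>R (B1 s \<omega> - B1 0 \<omega>))) \<longlonglongrightarrow> X1 t \<omega>" and
    conv2: "AE \<omega> in M2. (\<lambda>k. scheme (N k) (L k) t
      (\<lambda>s\<in>{0..}. X2 0 \<omega> + sqrt (2 * \<sigma>) *\<^sub>R (B2 s \<omega> - B2 0 \<omega>))) \<longlonglongrightarrow> X2 t \<omega>" and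
    stable: "\<And>k (y :: real \<Rightarrow> (real, 'n) vec) y'. \<forall>s\<ge>0. y s - y' s = y 0 - y' 0 \<Longrightarrow>
      norm (scheme (N k) (L k) t y - scheme (N k) (L k) t y') \<le> (exp (c * t) + (1/2) ^ k) * norm (y 0 - y' 0)"
    using common_subsequence[OF sol1 sol2 t] by blast
  define R where "R u k z = scheme (N k) (L k) t (\<lambda>s\<in>{0..}. Z u s z)" for u k z
  define S where "S u z = lim (\<lambda>k. R u k z)" for u z
  have driver_meas:
    "\<forall>s\<ge>0. (\<lambda>\<omega>. X1 0 \<omega> + sqrt (2 * \<sigma>) *\<^sub>R (B1 s \<omega> - B1 0 \<omega>)) \<in> borel_measurable M1"
    "\<forall>s\<ge>0. (\<lambda>\<omega>. X2 0 \<omega> + sqrt (2 * \<sigma>) *\<^sub>R (B2 s \<omega> - B2 0 \<omega>)) \<in> borel_measurable M2"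
    "\<forall>s\<ge>0. Z fst s \<in> borel_measurable \<Omega>" "\<forall>s\<ge>0. Z snd s \<in> borel_measurable \<Omega>"
    using driver_measurable[OF sol1] driver_measurable[OF sol2] Z_meas[OF proj(1)] Z_meas[OF proj(2)]
    by blast+
  note transfer1 = path_law_transfer[OF driver_meas(1,3) law1 scheme_measurable[OF t]
      particle_adapted_measurable[OF sol1 t] conv1, folded R_def, folded S_def]
  note transfer2 = path_law_transfer[OF driver_meas(2,4) law2 scheme_measurable[OF t]
      particle_adapted_measurable[OF sol2 t] conv2, folded R_def, folded S_def]
  have R_meas[measurable]: "R u k \<in> borel_measurable \<Omega>" if u: "u \<in> borel_measurable \<pi>" for u k
    unfolding R_def scheme_restrict[OF t] by (intro scheme_path_measurable[OF t] Z_meas[OF u])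
  have S_meas[measurable]: "S u \<in> borel_measurable \<Omega>" if "u \<in> borel_measurable \<pi>" for u
    unfolding S_def by (intro borel_measurable_lim_metric R_meas that)
  have S12[measurable]: "S fst \<in> borel_measurable \<Omega>" "S snd \<in> borel_measurable \<Omega>"
    by (intro S_meas proj)+
  define \<pi>' where "\<pi>' = distr \<Omega> (?b \<Otimes>\<^sub>M ?b) (\<lambda>z. (S fst z, S snd z))"
  have "\<pi>' \<in> couplings (distr M1 borel (X1 t)) (distr M2 borel (X2 t))"
    unfolding couplings_def
  proof (intro CollectI conjI)
    show "sets \<pi>' = sets (distr M1 borel (X1 t) \<Otimes>\<^sub>M distr M2 borel (X2 t))"
      by (simp add: \<pi>'_def cong: sets_pair_measure_cong)
    have "distr \<pi>' (distr M1 borel (X1 t)) fst = distr \<pi>' ?b fst" by (rule distr_cong) auto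
    also have "\<dots> = distr \<Omega> ?b (S fst)"
      unfolding \<pi>'_def by (subst distr_distr) (auto simp: comp_def)
    finally show "distr \<pi>' (distr M1 borel (X1 t)) fst = distr M1 borel (X1 t)"
      by (simp only: transfer1(2))
    have "distr \<pi>' (distr M2 borel (X2 t)) snd = distr \<pi>' ?b snd" by (rule distr_cong) auto
    also have "\<dots> = distr \<Omega> ?b (S snd)"
      unfolding \<pi>'_def by (subst distr_distr) (auto simp: comp_def)
    finally show "distr \<pi>' (distr M2 borel (X2 t)) snd = distr M2 borel (X2 t)"
      by (simp only: transfer2(2))
  qed
  moreover have "(\<integral>\<^sup>+p. ennreal ((dist (fst p) (snd p))\<^sup>2) \<partial>\<pi>')
      \<le> ennreal ((exp (c * t))\<^sup>2) * (\<integral>\<^sup>+p. ennreal ((dist (fst p) (snd p))\<^sup>2) \<partial>\<pi>)"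
  proof -
    let ?d = "\<lambda>p :: (real, 'n) vec \<times> (real, 'n) vec. ennreal ((dist (fst p) (snd p))\<^sup>2)"
    have d_meas: "?d \<in> borel_measurable (?b \<Otimes>\<^sub>M ?b)" by measurable
    then have d_meas_\<pi>: "?d \<in> borel_measurable \<pi>" by measurable
    have "(\<integral>\<^sup>+p. ?d p \<partial>\<pi>') = (\<integral>\<^sup>+z. ?d (S fst z, S snd z) \<partial>\<Omega>)"
      unfolding \<pi>'_def by (rule nn_integral_distr) (auto simp: d_meas)
    also have "\<dots> \<le> (\<integral>\<^sup>+z. ennreal ((exp (c * t))\<^sup>2) * ?d (fst z) \<partial>\<Omega>)"
    proof (rule nn_integral_mono_AE)
      show "AE z in \<Omega>. ?d (S fst z, S snd z) \<le> ennreal ((exp (c * t))\<^sup>2) * ?d (fst z)"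
        using transfer1(1) transfer2(1)
      proof eventually_elim
        case (elim z)
        then have lims: "(\<lambda>k. R fst k z) \<longlonglongrightarrow> S fst z" "(\<lambda>k. R snd k z) \<longlonglongrightarrow> S snd z"
          unfolding S_def by (simp_all add: convergent_LIMSEQ_iff)
        \<comment> \<open>Both drivers use the same \<open>W\<close>, so at all times they differ by
          the difference of the two initial values.\<close>
        have "norm (R fst k z - R snd k z) \<le> (exp (c * t) + (1/2) ^ k) * norm (fst (fst z) - snd (fst z))" for k
          using stable[of "\<lambda>s. Z fst s z" "\<lambda>s. Z snd s z" k]
          unfolding R_def scheme_restrict[OF t] by (simp add: Z_def)
        moreover have "(\<lambda>k. (exp (c * t) + (1/2) ^ k) * norm (fst (fst z) - snd (fst z)))
            \<longlonglongrightarrow> (exp (c * t) + 0) * norm (fst (fst z) - snd (fst z))"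
          by (intro tendsto_intros LIMSEQ_realpow_zero) auto
        moreover have "(\<lambda>k. norm (R fst k z - R snd k z)) \<longlonglongrightarrow> norm (S fst z - S snd z)"
          by (intro tendsto_intros lims)
        ultimately have "norm (S fst z - S snd z) \<le> (exp (c * t) + 0) * norm (fst (fst z) - snd (fst z))"
          by (intro LIMSEQ_le) auto
        then have "(dist (S fst z) (S snd z))\<^sup>2 \<le> (exp (c * t) * dist (fst (fst z)) (snd (fst z)))\<^sup>2"
          by (intro power_mono) (simp_all add: dist_norm)
        then show ?case
          by (simp add: power_mult_distrib ennreal_mult[symmetric] ennreal_leI)
      qed
    qed
    also have "\<dots> = ennreal ((exp (c * t))\<^sup>2) * (\<integral>\<^sup>+z. ?d (fst z) \<partial>\<Omega>)"
      by (rule nn_integral_cmult)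
        (use measurable_compose[OF measurable_fst d_meas_\<pi>] in \<open>simp add: \<Omega>_def\<close>)
    also have "(\<integral>\<^sup>+z. ?d (fst z) \<partial>\<Omega>) = (\<integral>\<^sup>+p. ?d p \<partial>distr \<Omega> \<pi> fst)"
      by (rule nn_integral_distr[symmetric]) (simp_all add: \<Omega>_def d_meas_\<pi>)
    also have "distr \<Omega> \<pi> fst = \<pi>"
      unfolding \<Omega>_def by (rule M1.distr_pair_fst)
    finally show ?thesis .
  qed
  ultimately show ?thesis by blast
qed

lemma wasserstein2_solutions:
  fixes X1 :: "real \<Rightarrow> 'b \<Rightarrow> real ^ 'n::{finite,linorder}"
    and X2 :: "real \<Rightarrow> 'c \<Rightarrow> real ^ 'n::{finite,linorder}"
  assumes "particle_solution \<alpha> \<sigma> U' M1 F1 B1 X1" "particle_solution \<alpha> \<sigma> U' M2 F2 B2 X2" "0 \<le> t"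
  shows "wasserstein2 (distr M1 borel (X1 t)) (distr M2 borel (X2 t))
    \<le> ennreal (exp (c * t)) * wasserstein2 (distr M1 borel (X1 0)) (distr M2 borel (X2 0))"
  by (rule wasserstein2_contraction[OF exp_gt_zero]) (rule coupled_solutions[OF assms])

text \<open>The exceptional null set comes from the two path equations and does not depend on time,
  so the estimate holds at all times simultaneously. The drivers share \<open>B\<close> and differ
  by X_0 - Y_0, even when the filtrations \<open>F\<close> and \<open>G\<close> are
  different.\<close>

lemma strong_stability:
  fixes X Y :: "real \<Rightarrow> 'a \<Rightarrow> real ^ 'n::{finite,linorder}"
  assumes X: "particle_solution \<alpha> \<sigma> U' M F B X" and Y: "particle_solution \<alpha> \<sigma> U' M G B Y"
  shows "AE \<omega> in M. \<forall>t\<ge>0. (\<Sum>i\<in>UNIV. (X t \<omega> $ i - Y t \<omega> $ i)\<^sup>2)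
      \<le> exp (2 * c * t) * (\<Sum>i\<in>UNIV. (X 0 \<omega> $ i - Y 0 \<omega> $ i)\<^sup>2)"
  using particle_path_solution[OF X] particle_path_solution[OF Y]
proof eventually_elim
  case (elim \<omega>)
  have sum: "(\<Sum>i\<in>UNIV. (v $ i - w $ i)\<^sup>2) = (norm (v - w))\<^sup>2" for v w :: "(real, 'n) vec"
    unfolding power2_norm_eq_inner by (simp add: inner_vec_def power2_eq_square)
  show ?case
    unfolding sum
  proof (intro allI impI)
    fix t :: real assume t: "0 \<le> t"
    have "norm (X t \<omega> - Y t \<omega>) \<le> exp (c * t) * norm (X 0 \<omega> - Y 0 \<omega>)"
      by (rule path_solution_stable[OF elim _ t]) simp
    then have "(norm (X t \<omega> - Y t \<omega>))\<^sup>2 \<le> (exp (c * t) * norm (X 0 \<omega> - Y 0 \<omega>))\<^sup>2"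
      by (intro power_mono) auto
    also have "\<dots> = exp (2 * c * t) * (norm (X 0 \<omega> - Y 0 \<omega>))\<^sup>2"
      by (simp add: power_mult_distrib exp_double[symmetric] mult.assoc)
    finally show "(norm (X t \<omega> - Y t \<omega>))\<^sup>2 \<le> exp (2 * c * t) * (norm (X 0 \<omega> - Y 0 \<omega>))\<^sup>2" .
  qed
qed

lemma strong_uniqueness:
  fixes X Y :: "real \<Rightarrow> 'a \<Rightarrow> real ^ 'n::{finite,linorder}"
  assumes X: "particle_solution \<alpha> \<sigma> U' M F B X" and Y: "particle_solution \<alpha> \<sigma> U' M G B Y"
    and start: "AE \<omega> in M. X 0 \<omega> = Y 0 \<omega>"
  shows "AE \<omega> in M. \<forall>t\<ge>0. X t \<omega> = Y t \<omega>"
  using strong_stability[OF X Y] start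
proof eventually_elim
  case (elim \<omega>)
  show ?case
  proof (intro allI impI)
    fix t :: real assume "0 \<le> t"
    with elim have "(\<Sum>i\<in>UNIV. (X t \<omega> $ i - Y t \<omega> $ i)\<^sup>2) \<le> 0" by simp
    then have "(\<Sum>i\<in>UNIV. (X t \<omega> $ i - Y t \<omega> $ i)\<^sup>2) = 0"
      by (intro antisym sum_nonneg) auto
    then show "X t \<omega> = Y t \<omega>"
      by (simp add: sum_nonneg_eq_0_iff vec_eq_iff)
  qed
qed

end

section \<open>Constants for the two classes of potentials\<close>

lemma one_sided_drift_of_bounded_derivative:
  assumes "0 \<le> \<alpha>" and deriv: "\<And>x. (U' has_real_derivative U'' x) (at x)" and bound: "\<And>x. \<bar>U'' x\<bar> \<le> L"
  shows "one_sided_drift \<alpha> U' L L"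
proof
  have lip: "\<bar>U' u - U' v\<bar> \<le> L * \<bar>u - v\<bar>" for u v
    using field_differentiable_bound[of UNIV U' U'' L u v] deriv bound by simp
  then show "\<bar>U' u - U' v\<bar> \<le> L * \<bar>u - v\<bar>" for u v .
  show "- L * (u - v)\<^sup>2 \<le> (u - v) * (U' u - U' v)" for u v
  proof -
    have "\<bar>(u - v) * (U' u - U' v)\<bar> \<le> \<bar>u - v\<bar> * (L * \<bar>u - v\<bar>)"
      unfolding abs_mult by (intro mult_left_mono lip) simp
    also have "\<dots> = L * (u - v)\<^sup>2"
      by (simp add: power2_eq_square mult.left_commute)
    finally show ?thesis by linarith
  qed
qed fact

text \<open>The one-sided condition holds with equality for the negative constant -\<lambda>; this
  convexity is the source of the contraction rate in (ii).\<close>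

lemma one_sided_drift_linear:
  assumes "0 \<le> \<alpha>" "0 < lam"
  shows "one_sided_drift \<alpha> (\<lambda>x. lam * x) (- lam) lam"
proof
  show "- (- lam) * (u - v)\<^sup>2 \<le> (u - v) * (lam * u - lam * v)" for u v
    by (simp add: power2_eq_square algebra_simps)
  show "\<bar>lam * u - lam * v\<bar> \<le> lam * \<bar>u - v\<bar>" for u v
    using assms(2) by (simp add: abs_mult flip: right_diff_distrib)
qed fact

theorem theorem3:
  fixes \<alpha> \<sigma> :: real and U U' U'' :: "real \<Rightarrow> real"
  assumes "\<alpha> \<ge> 1" and "\<sigma> \<ge> 0"
    and "\<And>x. (U has_real_derivative U' x) (at x)"
    and "\<And>x. (U' has_real_derivative U'' x) (at x)"
    and "continuous_on UNIV U''"
  shows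
    "(\<forall>L. (\<forall>x. \<bar>U'' x\<bar> \<le> L) \<longrightarrow>
       (\<forall>(M :: 'a measure) F G B (X :: real \<Rightarrow> 'a \<Rightarrow> real ^ 'n::{finite,linorder}) Y.
          particle_solution \<alpha> \<sigma> U' M F B X \<and> particle_solution \<alpha> \<sigma> U' M G B Y \<longrightarrow>
          (AE \<omega> in M. \<forall>t\<ge>0.
             (\<Sum>i\<in>UNIV. (X t \<omega> $ i - Y t \<omega> $ i)\<^sup>2)
               \<le> exp (2 * L * t) * (\<Sum>i\<in>UNIV. (X 0 \<omega> $ i - Y 0 \<omega> $ i)\<^sup>2)) \<and>
          ((AE \<omega> in M. X 0 \<omega> = Y 0 \<omega>) \<longrightarrow> (AE \<omega> in M. \<forall>t\<ge>0. X t \<omega> = Y t \<omega>))))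
     \<and>
     (\<forall>lam > 0. U = (\<lambda>x. lam / 2 * x\<^sup>2) \<longrightarrow>
       (\<forall>(M1 :: 'b measure) F1 B1 (X1 :: real \<Rightarrow> 'b \<Rightarrow> real ^ 'n::{finite,linorder})
         (M2 :: 'c measure) F2 B2 (X2 :: real \<Rightarrow> 'c \<Rightarrow> real ^ 'n::{finite,linorder}).
          particle_solution \<alpha> \<sigma> U' M1 F1 B1 X1 \<and> particle_solution \<alpha> \<sigma> U' M2 F2 B2 X2 \<and>
          (AE x in distr M1 borel (X1 0). x \<in> ordered_configs) \<and>
          (AE x in distr M2 borel (X2 0). x \<in> ordered_configs) \<longrightarrow>
          (\<forall>t\<ge>0. wasserstein2 (distr M1 borel (X1 t)) (distr M2 borel (X2 t))
             \<le> ennreal (exp (- lam * t))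
                 * wasserstein2 (distr M1 borel (X1 0)) (distr M2 borel (X2 0)))))
     \<and>
     (\<forall>L. (\<forall>x. \<bar>U'' x\<bar> \<le> L) \<longrightarrow>
       (\<forall>(M1 :: 'b measure) F1 B1 (X1 :: real \<Rightarrow> 'b \<Rightarrow> real ^ 'n::{finite,linorder})
         (M2 :: 'c measure) F2 B2 (X2 :: real \<Rightarrow> 'c \<Rightarrow> real ^ 'n::{finite,linorder}).
          particle_solution \<alpha> \<sigma> U' M1 F1 B1 X1 \<and> particle_solution \<alpha> \<sigma> U' M2 F2 B2 X2 \<and>
          (AE x in distr M1 borel (X1 0). x \<in> ordered_configs) \<and>
          (AE x in distr M2 borel (X2 0). x \<in> ordered_configs) \<longrightarrow>
          (\<forall>t\<ge>0. wasserstein2 (distr M1 borel (X1 t)) (distr M2 borel (X2 t))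
             \<le> ennreal (exp (L * t))
                 * wasserstein2 (distr M1 borel (X1 0)) (distr M2 borel (X2 0)))))"
proof (intro conjI allI impI)
  have \<alpha>: "0 \<le> \<alpha>" using assms(1) by simp
  note drift_L = one_sided_drift_of_bounded_derivative[OF \<alpha> assms(4)]
  {
    fix L and M :: "'a measure" and F G B and X Y :: "real \<Rightarrow> 'a \<Rightarrow> (real, 'n) vec"
    assume L: "\<forall>x. \<bar>U'' x\<bar> \<le> L"
      and sol: "particle_solution \<alpha> \<sigma> U' M F B X \<and> particle_solution \<alpha> \<sigma> U' M G B Y"
    interpret one_sided_drift \<alpha> U' L L using drift_L L by simp
    show "AE \<omega> in M. \<forall>t\<ge>0. (\<Sum>i\<in>UNIV. (X t \<omega> $ i - Y t \<omega> $ i)\<^sup>2)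
        \<le> exp (2 * L * t) * (\<Sum>i\<in>UNIV. (X 0 \<omega> $ i - Y 0 \<omega> $ i)\<^sup>2)"
      by (rule strong_stability[OF conjunct1[OF sol] conjunct2[OF sol]])
    show "AE \<omega> in M. \<forall>t\<ge>0. X t \<omega> = Y t \<omega>" if "AE \<omega> in M. X 0 \<omega> = Y 0 \<omega>"
      by (rule strong_uniqueness[OF conjunct1[OF sol] conjunct2[OF sol] that])
  }
  {
    fix lam :: real and M1 :: "'b measure" and F1 B1 and X1 :: "real \<Rightarrow> 'b \<Rightarrow> (real, 'n) vec"
      and M2 :: "'c measure" and F2 B2 and X2 :: "real \<Rightarrow> 'c \<Rightarrow> (real, 'n) vec" and t :: real
    assume lam: "lam > 0" and U: "U = (\<lambda>x. lam / 2 * x\<^sup>2)"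
      and sol: "particle_solution \<alpha> \<sigma> U' M1 F1 B1 X1 \<and> particle_solution \<alpha> \<sigma> U' M2 F2 B2 X2 \<and>
          (AE x in distr M1 borel (X1 0). x \<in> ordered_configs) \<and>
          (AE x in distr M2 borel (X2 0). x \<in> ordered_configs)"
      and t: "0 \<le> t"
    \<comment> \<open>\<open>U'\<close> is given only as a derivative of \<open>U\<close>, so its
      linear form comes from uniqueness of derivatives.\<close>
    have "U' = (\<lambda>x. lam * x)"
    proof
      fix x
      have "(U has_real_derivative lam * x) (at x)"
        unfolding U by (auto intro!: derivative_eq_intros)
      with assms(3) show "U' x = lam * x" by (rule DERIV_unique)
    qed
    then interpret one_sided_drift \<alpha> U' "- lam" lam
      using one_sided_drift_linear[OF \<alpha> lam] by simp
    show "wasserstein2 (distr M1 borel (X1 t)) (distr M2 borel (X2 t))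
        \<le> ennreal (exp (- lam * t)) * wasserstein2 (distr M1 borel (X1 0)) (distr M2 borel (X2 0))"
      by (rule wasserstein2_solutions[OF conjunct1[OF sol] conjunct1[OF conjunct2[OF sol]] t])
  }
  {
    fix L and M1 :: "'b measure" and F1 B1 and X1 :: "real \<Rightarrow> 'b \<Rightarrow> (real, 'n) vec"
      and M2 :: "'c measure" and F2 B2 and X2 :: "real \<Rightarrow> 'c \<Rightarrow> (real, 'n) vec" and t :: real
    assume L: "\<forall>x. \<bar>U'' x\<bar> \<le> L"
      and sol: "particle_solution \<alpha> \<sigma> U' M1 F1 B1 X1 \<and> particle_solution \<alpha> \<sigma> U' M2 F2 B2 X2 \<and>
          (AE x in distr M1 borel (X1 0). x \<in> ordered_configs) \<and>
          (AE x in distr M2 borel (X2 0). x \<in> ordered_configs)"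
      and t: "0 \<le> t"
    interpret one_sided_drift \<alpha> U' L L using drift_L L by simp
    show "wasserstein2 (distr M1 borel (X1 t)) (distr M2 borel (X2 t))
        \<le> ennreal (exp (L * t)) * wasserstein2 (distr M1 borel (X1 0)) (distr M2 borel (X2 0))"
      by (rule wasserstein2_solutions[OF conjunct1[OF sol] conjunct1[OF conjunct2[OF sol]] t])
  }
qed

end
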